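(* There exists a constant $D$ such that $M_{2,2}(n) \leq Dn$ for all $n$.
   Context: For a finite set $S \subset \mathbb{R}^d$, the Vietoris–Rips complex $R(S)$ is the simplicial complex on vertex set $S$ whose faces are all subsets of $S$ of (Euclidean) diameter at most $1$. For a fixed field $\mathbf{k}$, $\tilde{\beta}_p(\Gamma)=\dim_{\mathbf{k}}\tilde{H}_p(\Gamma;\mathbf{k})$ denotes the $p$-th reduced Betti number. Define $M_{p,d}(n) := \max\{\tilde{\beta}_p(R(S)) : S \subset \mathbb{R}^d,\ |S| \leq n\}$. *)

theory Defs
  imports
    "HOL-Analysis.Analysis"
    "HOL-Algebra.AbelCoset"
    "HOL-Combinatorics.Permutations"
    "Jordan_Normal_Form.Missing_VectorSpace"
begin

definition rips_complex :: "'a::metric_space set \<Rightarrow> 'a set set"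
  where "rips_complex S = {\<sigma>. \<sigma> \<subseteq> S \<and> diameter \<sigma> \<le> 1}"


text \<open>
  A simplicial complex is a downward closed set \<open>K\<close> of finite sets that contains the empty face.
  Ordered simplices are lists of distinct vertices. As usual, an oriented chain is a function on
  ordered simplices that is alternating under reordering of the vertices. Chain spaces are indexed
  by the number \<open>m\<close> of vertices, so \<open>m = p + 1\<close> corresponds to dimension \<open>p\<close> and \<open>m = 0\<close> is the
  one-dimensional space in dimension \<open>-1\<close> of the augmented complex, spanned by the empty face.
  The fields \<open>mult\<close> and \<open>one\<close> of the module record play no role.
\<close>

definition chain_space :: "'v set set \<Rightarrow> nat \<Rightarrow> ('k::field, 'v list \<Rightarrow> 'k) module"
  where "chain_space K m =
    \<lparr> carrier = {c. (\<forall>xs. c xs \<noteq> 0 \<longrightarrow> distinct xs \<and> length xs = m \<and> set xs \<in> K) \<and>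
                   (\<forall>\<pi> xs. \<pi> permutes {..<m} \<longrightarrow> length xs = m \<longrightarrow>
                      c (permute_list \<pi> xs) = of_int (sign \<pi>) * c xs)},
      mult = undefined, one = undefined,
      zero = (\<lambda>xs. 0), add = (\<lambda>c d xs. c xs + d xs), smult = (\<lambda>a c xs. a * c xs) \<rparr>"

text \<open>
  The chain \<open>[v\<^sub>0, \<dots>, v\<^sub>p]\<close> takes the value \<open>(-1)\<^sup>i\<close> at the ordering that moves \<open>v\<^sub>i\<close> to the front.
  So the formula below is the linear extension of
  \<open>\<partial>[v\<^sub>0, \<dots>, v\<^sub>p] = \<Sum>\<^sub>i (-1)\<^sup>i [v\<^sub>0, \<dots>, v\<^sub>i\<^sub>-\<^sub>1, v\<^sub>i\<^sub>+\<^sub>1, \<dots>, v\<^sub>p]\<close>; for \<open>p = 0\<close> it is the augmentation.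
\<close>

definition boundary :: "'v set set \<Rightarrow> ('v list \<Rightarrow> 'k::field) \<Rightarrow> 'v list \<Rightarrow> 'k"
  where "boundary K c = (\<lambda>ys. \<Sum>v\<in>\<Union>K. c (v # ys))"

definition cycle_space :: "'v set set \<Rightarrow> nat \<Rightarrow> ('k::field, 'v list \<Rightarrow> 'k) module"
  where "cycle_space K m =
    (chain_space K m) \<lparr> carrier := {c \<in> carrier (chain_space K m). boundary K c = (\<lambda>ys. 0)} \<rparr>"

definition boundaries :: "'v set set \<Rightarrow> nat \<Rightarrow> ('v list \<Rightarrow> 'k::field) set"
  where "boundaries K m = boundary K ` carrier (chain_space K (Suc m))"

text \<open>
  In the scalar multiplication of the quotient, the union makes \<open>a \<odot> X\<close> a full coset of \<open>N\<close>
  also for \<open>a = 0\<close>.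
\<close>

definition quotient_space :: "('k, 'm) module \<Rightarrow> 'm set \<Rightarrow> ('k, 'm set) module"
  where "quotient_space M N =
    \<lparr> carrier = a_rcosets\<^bsub>M\<^esub> N, mult = undefined, one = undefined,
      zero = N, add = (\<lambda>X Y. X <+>\<^bsub>M\<^esub> Y),
      smult = (\<lambda>a X. \<Union>x\<in>X. N +>\<^bsub>M\<^esub> (a \<odot>\<^bsub>M\<^esub> x)) \<rparr>"

definition reduced_homology :: "'v set set \<Rightarrow> nat \<Rightarrow> ('k::field, ('v list \<Rightarrow> 'k) set) module"
  where "reduced_homology K p = quotient_space (cycle_space K (Suc p)) (boundaries K (Suc p))"

abbreviation scalar_field :: "'k::field ring"
  where "scalar_field \<equiv> \<lparr> carrier = UNIV, mult = (*), one = 1, zero = 0, add = (+) \<rparr>"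

definition reduced_betti :: "'k::field itself \<Rightarrow> 'v set set \<Rightarrow> nat \<Rightarrow> nat"
  where "reduced_betti _ K p =
    vectorspace.dim scalar_field (reduced_homology K p :: ('k, ('v list \<Rightarrow> 'k) set) module)"

text \<open>
  The ambient dimension \<open>d\<close> is the cardinality of the index type \<open>'d\<close>.
\<close>

definition max_rips_betti :: "'k::field itself \<Rightarrow> 'd::finite itself \<Rightarrow> nat \<Rightarrow> nat \<Rightarrow> nat"
  where "max_rips_betti k d p n =
    Max {reduced_betti k (rips_complex S) p |S :: (real ^ 'd) set. finite S \<and> card S \<le> n}"

end

theory Submission
  imports Defs "HOL-Library.Function_Algebras"
begin

text \<open>
  Cut the plane into grid cells of diameter less than \<open>1/100\<close>, so that points of a common cell are
  adjacent. Triangles are sorted by the set of cells they meet. As in discrete Morse theory, a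
  cycle is cleared triangle by triangle: a triangle costs nothing if it can be pushed across a
  tetrahedron onto cleared ones, or if one of its edges lies in no other remaining triangle, and
  otherwise it costs one generator. The number of generators bounds the Betti number.

  Triangles in one cell are free, since a full simplex is a cone. For two cells \<open>c\<close>, \<open>d\<close> the points
  of \<open>d\<close> are removed one by one. Order them along the direction perpendicular to the one from \<open>c\<close>
  to \<open>d\<close>. If some unit disc around a point of \<open>c\<close> contains \<open>a\<close> and \<open>e\<close> but not \<open>b\<close> between them, then
  every such disc that contains \<open>b\<close> contains \<open>a\<close> or \<open>e\<close>, and removing \<open>b\<close> costs at most one; if there
  is no such \<open>b\<close>, then all discs cut out intervals and the first point can be removed.

  For three cells only the components of the graph of triangles matter, where two triangles are
  joined if they differ in one vertex. If two of the cells are completely joined, then the triangles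
  at a point of the third cell are connected. Otherwise all triangles are nearly equilateral. Take
  unconnected triangles \<open>{u, v, w}\<close> and \<open>{u, v', w'}\<close> with \<open>|v - v'|\<close> maximal and \<open>v'\<close> nearer to \<open>u\<close>.
  The displacement from \<open>v\<close> to \<open>v'\<close> is almost perpendicular to \<open>vw\<close>, so it is not perpendicular to
  \<open>uv\<close>, and \<open>uv'\<close> is shorter than \<open>1\<close> by an amount comparable to \<open>|v - v'|\<close>. An unconnected triangle
  \<open>{u'', v'', w'}\<close> would have \<open>|uv''| > 1\<close> with \<open>v'' - v'\<close> almost perpendicular to \<open>uv\<close>, which forces
  \<open>|v'' - v'| > |v - v'|\<close>. So all triangles at \<open>w'\<close> are connected, and \<open>w'\<close> can be removed at cost one.

  Every point lies in boundedly many cell sets that are met by triangles, so the total is linear.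
\<close>

section \<open>Chains, cycles and the dimension of homology\<close>

text \<open>Named so that functions form an instance of the locale \<open>vector_space\<close>.
  Spans and subspaces of chains are taken there, not in the module records.\<close>

definition fscale :: "'k::field \<Rightarrow> ('a \<Rightarrow> 'k) \<Rightarrow> 'a \<Rightarrow> 'k"
  where "fscale a f = (\<lambda>x. a * f x)"

lemma fscale_apply [simp]: "fscale a f x = a * f x"
  by (simp add: fscale_def)

interpretation fun_vs: vector_space "fscale :: 'k::field \<Rightarrow> ('a \<Rightarrow> 'k) \<Rightarrow> 'a \<Rightarrow> 'k"
  by unfold_locales (auto simp: fun_eq_iff algebra_simps)

section \<open>Alternating chains\<close>

lemma chain_space_iff:
  "c \<in> carrier (chain_space K m) \<longleftrightarrow>
    (\<forall>xs. c xs \<noteq> 0 \<longrightarrow> distinct xs \<and> length xs = m \<and> set xs \<in> K) \<and>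
    (\<forall>\<pi> xs. \<pi> permutes {..<m} \<longrightarrow> length xs = m \<longrightarrow>
      c (permute_list \<pi> xs) = of_int (sign \<pi>) * c xs)"
  by (simp add: chain_space_def)

lemma chain_supportD:
  assumes "c \<in> carrier (chain_space K m)" "c xs \<noteq> 0"
  shows "distinct xs" "length xs = m" "set xs \<in> K"
  using assms by (auto simp: chain_space_iff)

lemma chain_permute:
  assumes "c \<in> carrier (chain_space K m)" "\<pi> permutes {..<m}" "length xs = m"
  shows "c (permute_list \<pi> xs) = of_int (sign \<pi>) * c xs"
  using assms by (auto simp: chain_space_iff)

lemma chain_zero: "0 \<in> carrier (chain_space K m)"
  by (simp add: chain_space_iff)

lemma chain_add:
  "c \<in> carrier (chain_space K m) \<Longrightarrow> d \<in> carrier (chain_space K m) \<Longrightarrow>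
    c + d \<in> carrier (chain_space K m)"
  unfolding chain_space_iff by (auto simp: algebra_simps) (metis add_0)+

lemma chain_fscale:
  "c \<in> carrier (chain_space K m) \<Longrightarrow> fscale a c \<in> carrier (chain_space K m)"
  unfolding chain_space_iff by auto

lemma boundary_add: "boundary K (c + d) = boundary K c + boundary K d"
  by (auto simp: boundary_def fun_eq_iff sum.distrib)

lemma boundary_fscale: "boundary K (fscale a c) = fscale a (boundary K c)"
  by (auto simp: boundary_def fun_eq_iff sum_distrib_left)

lemma boundary_zero: "boundary K 0 = 0"
  by (auto simp: boundary_def fun_eq_iff)

text \<open>Alternation makes the values at two orderings of one face agree up to sign; at lists of
  another length than \<open>m\<close> all values are zero.\<close>

lemma zero_same_set:
  assumes "c \<in> carrier (chain_space K m)" "c xs = 0" "distinct xs" "distinct ys" "set xs = set ys"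
  shows "c ys = 0"
proof (cases "length xs = m")
  case True
  have "mset ys = mset xs"
    using assms by (simp add: set_eq_iff_mset_eq_distinct)
  then obtain \<pi> where "\<pi> permutes {..<length xs}" "permute_list \<pi> xs = ys"
    using mset_eq_permutation by blast
  then show ?thesis
    using chain_permute[OF assms(1), of \<pi> xs] True assms(2) by auto
next
  case False
  moreover have "length ys = length xs"
    using assms by (metis distinct_card)
  ultimately show ?thesis
    using chain_supportD(2)[OF assms(1)] by fastforce
qed

text \<open>This is \<open>p\<close> with a new fixed point 0 in front. It reorders
  \<open>v # ys\<close> without moving \<open>v\<close>, which carries alternation of a chain over
  to its boundary.\<close>

definition shift_perm :: "(nat \<Rightarrow> nat) \<Rightarrow> nat \<Rightarrow> nat"
  where "shift_perm p i = (case i of 0 \<Rightarrow> 0 | Suc j \<Rightarrow> Suc (p j))"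

lemma shift_perm_transpose_comp:
  "shift_perm (Transposition.transpose a b \<circ> p) = Transposition.transpose (Suc a) (Suc b) \<circ> shift_perm p"
  by (auto simp: fun_eq_iff shift_perm_def Transposition.transpose_def split: nat.splits)

text \<open>Induction over a product of transpositions: each one is shifted to a transposition, so
  the sign is kept.\<close>

lemma shift_perm_permutes_sign:
  assumes "p permutes {..<m}"
  shows "shift_perm p permutes {..<Suc m} \<and> sign (shift_perm p) = sign p"
proof -
  from assms finite_lessThan[of m] show ?thesis
  proof (induction rule: permutes_induct)
    case id
    have "shift_perm id = id"
      by (auto simp: fun_eq_iff shift_perm_def split: nat.splits)
    then show ?case by (simp only: permutes_id sign_id simp_thms)
  next
    case (swap a b p)
    then have perm: "permutation p" "permutation (shift_perm p)"
      by (auto intro: permutation_permutes[THEN iffD2] finite_lessThan)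
    have "Transposition.transpose (Suc a) (Suc b) permutes {..<Suc m}"
      using swap by (intro permutes_swap_id) auto
    then have "shift_perm (Transposition.transpose a b \<circ> p) permutes {..<Suc m}"
      unfolding shift_perm_transpose_comp using swap by (intro permutes_compose) auto
    moreover have "sign (shift_perm (Transposition.transpose a b \<circ> p)) = sign (Transposition.transpose a b \<circ> p)"
      unfolding shift_perm_transpose_comp
      using swap perm by (simp add: sign_compose sign_swap_id permutation_swap_id)
    ultimately show ?case by blast
  qed
qed

lemma permute_list_shift_perm:
  "permute_list (shift_perm p) (v # ys) = v # permute_list p ys"
proof -
  have *: "[0..<Suc (length ys)] = 0 # map Suc [0..<length ys]"
    by (simp add: map_Suc_upt upt_conv_Cons del: upt_Suc)
  show ?thesis
    unfolding permute_list_def list.size(4) add_Suc_right add_0_right * by (simp add: shift_perm_def)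
qed

text \<open>Terms off the diagonal cancel in pairs. The diagonal has a hypothesis of its own because
  in characteristic 2 antisymmetry does not make it vanish.\<close>

lemma sum_antisym_zero:
  fixes f :: "'a \<Rightarrow> 'a \<Rightarrow> 'k::ring"
  assumes "finite A" "\<And>x. x \<in> A \<Longrightarrow> f x x = 0"
    "\<And>x y. x \<in> A \<Longrightarrow> y \<in> A \<Longrightarrow> x \<noteq> y \<Longrightarrow> f x y = - f y x"
  shows "(\<Sum>x\<in>A. \<Sum>y\<in>A. f x y) = 0"
  using assms
proof (induction A rule: finite_induct)
  case (insert a A)
  have "f x a = - f a x" if "x \<in> A" for x
    using insert.prems(2)[of x a] insert.hyps(2) that by blast
  then have "(\<Sum>x\<in>A. f x a) = - (\<Sum>x\<in>A. f a x)"
    by (simp add: sum_negf)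
  moreover have "(\<Sum>x\<in>A. \<Sum>y\<in>A. f x y) = 0"
    by (rule insert.IH) (use insert.prems in blast)+
  moreover have "f a a = 0"
    using insert.prems(1) by blast
  ultimately show ?case
    using insert.hyps by (simp add: sum.distrib)
qed (simp only: sum.empty)

text \<open>The oriented simplex with vertex order \<open>ts\<close>. For distinct \<open>ts\<close>
  a reordering determines its permutation (\<open>permute_list_inj\<close>), so \<open>THE\<close>
  is then well defined.\<close>

definition elem_chain :: "'v list \<Rightarrow> 'v list \<Rightarrow> 'k::field"
  where "elem_chain ts xs =
    (if \<exists>\<pi>. \<pi> permutes {..<length ts} \<and> permute_list \<pi> ts = xs
     then of_int (sign (THE \<pi>. \<pi> permutes {..<length ts} \<and> permute_list \<pi> ts = xs)) else 0)"

lemma permute_list_inj: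
  assumes "distinct ts" "p permutes {..<length ts}" "q permutes {..<length ts}"
    "permute_list p ts = permute_list q ts"
  shows "p = q"
proof
  fix i
  show "p i = q i"
  proof (cases "i < length ts")
    case True
    then have "ts ! p i = ts ! q i"
      using assms permute_list_nth[of p ts i] permute_list_nth[of q ts i] by simp
    moreover have "p i < length ts" "q i < length ts"
      using True assms(2,3)[THEN permutes_in_image] by auto
    ultimately show ?thesis
      using assms(1) nth_eq_iff_index_eq by blast
  next
    case False
    then show ?thesis using assms(2,3) by (simp add: permutes_not_in)
  qed
qed

lemma elem_chain_permute:
  assumes "distinct ts" "p permutes {..<length ts}"
  shows "elem_chain ts (permute_list p ts) = of_int (sign p)"
proof -
  have "(THE \<pi>. \<pi> permutes {..<length ts} \<and> permute_list \<pi> ts = permute_list p ts) = p"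
    using assms permute_list_inj by (intro the_equality) blast+
  then show ?thesis
    using assms by (auto simp: elem_chain_def)
qed

text \<open>The value is a sign, and both signs are nonzero in every field.\<close>

lemma elem_chain_nonzero:
  assumes "distinct ts" "distinct xs" "set xs = set ts"
  shows "(elem_chain ts xs :: 'k::field) \<noteq> 0"
proof -
  have "mset xs = mset ts"
    using assms by (simp add: set_eq_iff_mset_eq_distinct)
  then obtain p where p: "p permutes {..<length ts}" "permute_list p ts = xs"
    using mset_eq_permutation by blast
  then have "elem_chain ts xs = (of_int (sign p) :: 'k)"
    using elem_chain_permute assms by blast
  then show ?thesis by (simp add: sign_def)
qed

lemma elem_chain_support:
  assumes "(elem_chain ts xs :: 'k::field) \<noteq> 0"
  shows "\<exists>p. p permutes {..<length ts} \<and> xs = permute_list p ts"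
  using assms by (auto simp: elem_chain_def split: if_splits)

lemma elem_chain_in_chain_space:
  assumes "distinct ts" "set ts \<in> K"
  shows "elem_chain ts \<in> carrier (chain_space K (length ts))"
  unfolding chain_space_iff
proof (intro conjI allI impI)
  fix xs :: "'a list" assume "(elem_chain ts xs :: 'b) \<noteq> 0"
  then obtain p where "p permutes {..<length ts}" "xs = permute_list p ts"
    using elem_chain_support by blast
  then show "distinct xs" "length xs = length ts" "set xs \<in> K"
    using assms by auto
next
  fix q and xs :: "'a list"
  assume q: "q permutes {..<length ts}" and len: "length xs = length ts"
  show "(elem_chain ts (permute_list q xs) :: 'b) = of_int (sign q) * elem_chain ts xs"
  proof (cases "\<exists>p. p permutes {..<length ts} \<and> xs = permute_list p ts")
    case True
    then obtain p where p: "p permutes {..<length ts}" "xs = permute_list p ts" by blast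
    have "permute_list q xs = permute_list (p \<circ> q) ts"
      using q p by (simp add: permute_list_compose)
    moreover have "sign (p \<circ> q) = sign p * sign q"
      using p q by (intro sign_compose) (auto intro: permutation_permutes[THEN iffD2] finite_lessThan)
    moreover have "elem_chain ts (permute_list (p \<circ> q) ts) = (of_int (sign (p \<circ> q)) :: 'b)"
      "elem_chain ts xs = (of_int (sign p) :: 'b)"
      using elem_chain_permute[OF assms(1)] permutes_compose[OF q p(1)] p by blast+
    ultimately show ?thesis by simp
  next
    case False
    have "elem_chain ts (permute_list q xs) = (0 :: 'b)"
    proof (rule ccontr)
      assume "elem_chain ts (permute_list q xs) \<noteq> (0 :: 'b)"
      then obtain p where p: "p permutes {..<length ts}" "permute_list q xs = permute_list p ts"
        using elem_chain_support by blast
      \<comment> \<open>Undoing \<open>q\<close> exhibits \<open>xs\<close> itself as a reordering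
        of \<open>ts\<close>.\<close>
      have "xs = permute_list (q \<circ> Hilbert_Choice.inv q) xs"
        using permutes_inv_o(1)[OF q] by simp
      also have "\<dots> = permute_list (Hilbert_Choice.inv q) (permute_list p ts)"
        using permutes_inv[OF q] p len by (simp add: permute_list_compose)
      also have "\<dots> = permute_list (p \<circ> Hilbert_Choice.inv q) ts"
        using permutes_inv[OF q] by (simp add: permute_list_compose)
      finally show False
        using False permutes_compose[OF permutes_inv[OF q] p(1)] by blast
    qed
    moreover have "elem_chain ts xs = (0 :: 'b)"
      using False elem_chain_support by blast
    ultimately show ?thesis by simp
  qed
qed

text \<open>The parameter \<open>F\<close> pins down the coefficient field, so that the spaces of
  cycles and boundaries below have fixed types.\<close>

locale finite_complex =
  fixes K :: "'v set set" and F :: "'k::field itself"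
  assumes finite_vertices: "finite (\<Union>K)"
    and face_closed: "\<sigma> \<in> K \<Longrightarrow> \<tau> \<subseteq> \<sigma> \<Longrightarrow> \<tau> \<in> K"
begin

lemma boundary_chain:
  assumes "c \<in> carrier (chain_space K (Suc m))"
  shows "boundary K c \<in> carrier (chain_space K m)"
  unfolding chain_space_iff
proof (intro conjI allI impI)
  fix ys assume "boundary K c ys \<noteq> 0"
  then obtain v where "c (v # ys) \<noteq> 0"
    unfolding boundary_def by (meson sum.not_neutral_contains_not_neutral)
  from chain_supportD[OF assms this] face_closed[of "set (v # ys)" "set ys"]
  show "distinct ys" "length ys = m" "set ys \<in> K" by auto
next
  fix p and ys :: "'v list" assume p: "p permutes {..<m}" and len: "length ys = m"
  have "c (v # permute_list p ys) = of_int (sign p) * c (v # ys)" for v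
    using chain_permute[OF assms, of "shift_perm p" "v # ys"] shift_perm_permutes_sign[OF p] len
    by (simp add: permute_list_shift_perm)
  then show "boundary K c (permute_list p ys) = of_int (sign p) * boundary K c ys"
    by (simp add: boundary_def sum_distrib_left)
qed

text \<open>The value at \<open>ys\<close> is a double sum over the two vertices put in front, and
  swapping them changes the sign.\<close>

lemma boundary_boundary:
  assumes "c \<in> carrier (chain_space K m)"
  shows "boundary K (boundary K c) = 0"
proof
  fix ys
  have diag: "c (x # x # ys) = 0" for x
    using chain_supportD(1)[OF assms, of "x # x # ys"] by auto
  have anti: "c (x # y # ys) = - c (y # x # ys)" for x y
  proof (cases "length ys + 2 = m")
    case True
    have p: "Transposition.transpose 0 1 permutes {..<m}"
      using True by (intro permutes_swap_id) auto
    have "permute_list (Transposition.transpose 0 1) (y # x # ys) = x # y # ys"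
    proof (rule nth_equalityI)
      fix i assume "i < length (permute_list (Transposition.transpose 0 1) (y # x # ys))"
      then show "permute_list (Transposition.transpose 0 1) (y # x # ys) ! i = (x # y # ys) ! i"
        using p True
        by (subst permute_list_nth) (auto simp: Transposition.transpose_def nth_Cons split: nat.splits)
    qed simp
    then show ?thesis
      using chain_permute[OF assms p, of "y # x # ys"] True by (simp add: sign_swap_id)
  next
    case False
    then have "c (x # y # ys) = 0" "c (y # x # ys) = 0"
      using chain_supportD(2)[OF assms] by fastforce+
    then show ?thesis by simp
  qed
  have "boundary K (boundary K c) ys = (\<Sum>x\<in>\<Union>K. \<Sum>y\<in>\<Union>K. c (y # x # ys))"
    by (simp add: boundary_def)
  also have "\<dots> = 0"
    by (rule sum_antisym_zero[OF finite_vertices]) (rule diag, rule anti)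
  finally show "boundary K (boundary K c) ys = 0 ys" by simp
qed

section \<open>Homology as a vector space\<close>

definition Z :: "nat \<Rightarrow> ('v list \<Rightarrow> 'k) set"
  where "Z m = carrier (cycle_space K m)"

definition B :: "nat \<Rightarrow> ('v list \<Rightarrow> 'k) set"
  where "B m = boundaries K m"

lemma Z_iff: "z \<in> Z m \<longleftrightarrow> z \<in> carrier (chain_space K m) \<and> boundary K z = 0"
  by (auto simp: Z_def cycle_space_def zero_fun_def)

lemma subspace_Z: "fun_vs.subspace (Z m)"
  unfolding fun_vs.subspace_def Z_iff
  by (auto simp: Z_iff chain_zero chain_add chain_fscale boundary_add boundary_fscale boundary_zero)

lemma subspace_B: "fun_vs.subspace (B m)"
  unfolding fun_vs.subspace_def B_def boundaries_def
proof (intro conjI ballI allI)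
  show "0 \<in> boundary K ` carrier (chain_space K (Suc m))"
    using chain_zero boundary_zero by (metis image_eqI)
next
  fix x y :: "'v list \<Rightarrow> 'k"
  assume "x \<in> boundary K ` carrier (chain_space K (Suc m))"
    "y \<in> boundary K ` carrier (chain_space K (Suc m))"
  then show "x + y \<in> boundary K ` carrier (chain_space K (Suc m))"
    by (auto simp flip: boundary_add intro!: imageI chain_add)
next
  fix a :: 'k and x :: "'v list \<Rightarrow> 'k"
  assume "x \<in> boundary K ` carrier (chain_space K (Suc m))"
  then show "fscale a x \<in> boundary K ` carrier (chain_space K (Suc m))"
    by (auto simp flip: boundary_fscale intro!: imageI chain_fscale)
qed

lemma B_subset_Z: "B m \<subseteq> Z m"
  by (auto simp: B_def boundaries_def Z_iff boundary_chain boundary_boundary)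

text \<open>The class of \<open>z\<close> as a bare set; \<open>coset_eq\<close> identifies it with
  the coset of the record.\<close>

definition hcoset :: "nat \<Rightarrow> ('v list \<Rightarrow> 'k) \<Rightarrow> ('v list \<Rightarrow> 'k) set"
  where "hcoset m z = {y. y - z \<in> B m}"

abbreviation H :: "nat \<Rightarrow> ('k, ('v list \<Rightarrow> 'k) set) module"
  where "H p \<equiv> reduced_homology K p"

lemma cycle_space_simps:
  "add (cycle_space K m) = ((+) :: ('v list \<Rightarrow> 'k) \<Rightarrow> _)"
  "zero (cycle_space K m) = (0 :: 'v list \<Rightarrow> 'k)"
  "smult (cycle_space K m) = (fscale :: 'k \<Rightarrow> ('v list \<Rightarrow> 'k) \<Rightarrow> _)"
  by (auto simp: cycle_space_def chain_space_def plus_fun_def zero_fun_def fscale_def fun_eq_iff)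

lemma coset_eq: "a_r_coset (cycle_space K m) (B m) z = hcoset m z"
proof -
  have "y - z \<in> B m \<longleftrightarrow> (\<exists>h\<in>B m. y = h + z)" for y
    by (metis add_diff_cancel_right' diff_add_cancel)
  then show ?thesis
    by (auto simp: a_r_coset_def r_coset_def hcoset_def cycle_space_simps)
qed

lemma carrier_H: "carrier (H p) = hcoset (Suc p) ` Z (Suc p)"
proof -
  have "carrier (H p) = (\<Union>z\<in>Z (Suc p). {a_r_coset (cycle_space K (Suc p)) (B (Suc p)) z})"
    by (simp add: reduced_homology_def quotient_space_def A_RCOSETS_def RCOSETS_def a_r_coset_def
        Z_def B_def)
  then show ?thesis by (auto simp: coset_eq)
qed

lemma hcoset_eq_iff: "hcoset m z = hcoset m w \<longleftrightarrow> z - w \<in> B m"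
proof
  assume "hcoset m z = hcoset m w"
  then have "z \<in> hcoset m w"
    using subspace_B[THEN fun_vs.subspace_0] by (auto simp: hcoset_def)
  then show "z - w \<in> B m" by (simp add: hcoset_def)
next
  assume zw: "z - w \<in> B m"
  have "y - z \<in> B m \<longleftrightarrow> y - w \<in> B m" for y
  proof
    assume "y - z \<in> B m"
    from fun_vs.subspace_add[OF subspace_B this zw] show "y - w \<in> B m" by simp
  next
    assume "y - w \<in> B m"
    from fun_vs.subspace_diff[OF subspace_B this zw] show "y - z \<in> B m" by simp
  qed
  then show "hcoset m z = hcoset m w" by (auto simp: hcoset_def)
qed

lemma add_H:
  "add (H p) (hcoset (Suc p) z) (hcoset (Suc p) w) = hcoset (Suc p) (z + w)"
proof -
  have "(\<exists>h\<in>hcoset m z. \<exists>k\<in>hcoset m w. y = h + k) \<longleftrightarrow> y \<in> hcoset m (z + w)" for y m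
  proof
    assume "\<exists>h\<in>hcoset m z. \<exists>k\<in>hcoset m w. y = h + k"
    then obtain h k where "h - z \<in> B m" "k - w \<in> B m" "y = h + k"
      by (auto simp: hcoset_def)
    from fun_vs.subspace_add[OF subspace_B this(1,2)] this(3)
    show "y \<in> hcoset m (z + w)" by (simp add: hcoset_def algebra_simps)
  next
    assume "y \<in> hcoset m (z + w)"
    then have "y - w \<in> hcoset m z" by (simp add: hcoset_def algebra_simps)
    moreover have "w \<in> hcoset m w"
      using subspace_B[THEN fun_vs.subspace_0] by (simp add: hcoset_def)
    moreover have "y = (y - w) + w" by simp
    ultimately show "\<exists>h\<in>hcoset m z. \<exists>k\<in>hcoset m w. y = h + k" by blast
  qed
  then show ?thesis
    unfolding reduced_homology_def quotient_space_def
    by (auto simp: set_add_def set_mult_def cycle_space_simps)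
qed

lemma smult_H:
  "smult (H p) a (hcoset (Suc p) z) = hcoset (Suc p) (fscale a z)"
proof -
  have "(\<Union>x\<in>hcoset m z. hcoset m (fscale a x)) = hcoset m (fscale a z)" for m
  proof -
    \<comment> \<open>All members of the coset yield the same scaled coset, so the union in the
      scalar multiplication collapses to it.\<close>
    have "hcoset m (fscale a x) = hcoset m (fscale a z)" if "x \<in> hcoset m z" for x
    proof -
      have "x - z \<in> B m" using that by (simp add: hcoset_def)
      from fun_vs.subspace_scale[OF subspace_B this, of a] show ?thesis
        by (simp add: hcoset_eq_iff fun_vs.scale_right_diff_distrib)
    qed
    moreover have "z \<in> hcoset m z"
      using subspace_B[THEN fun_vs.subspace_0] by (simp add: hcoset_def)
    ultimately show ?thesis by blast
  qed
  then show ?thesis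
    unfolding reduced_homology_def quotient_space_def
    by (simp add: B_def[symmetric] coset_eq cycle_space_simps)
qed

lemma zero_H: "zero (H p) = hcoset (Suc p) 0"
  by (auto simp: reduced_homology_def quotient_space_def hcoset_def B_def)

lemma cring_scalar: "cring (scalar_field :: 'k ring)"
proof (rule cringI)
  show "abelian_group (scalar_field :: 'k ring)"
    by (rule abelian_groupI) (auto simp: algebra_simps intro: exI[of _ "- _"])
  show "Group.comm_monoid (scalar_field :: 'k ring)"
    by (rule comm_monoidI) (auto simp: algebra_simps)
qed (auto simp: algebra_simps)

lemma field_scalar: "Ring.field (scalar_field :: 'k ring)"
proof (rule cring.cring_fieldI2[OF cring_scalar])
  fix a :: 'k
  assume "a \<in> carrier scalar_field" "a \<noteq> \<zero>\<^bsub>scalar_field\<^esub>"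
  then show "\<exists>b\<in>carrier scalar_field. a \<otimes>\<^bsub>scalar_field\<^esub> b = \<one>\<^bsub>scalar_field\<^esub>"
    by (auto intro: exI[of _ "inverse a"])
qed auto

lemma vectorspace_H: "vectorspace scalar_field (H p)"
proof -
  let ?m = "Suc p"
  note sub = subspace_Z[of ?m]
  note Zc = fun_vs.subspace_0[OF sub] fun_vs.subspace_add[OF sub] fun_vs.subspace_scale[OF sub]
    fun_vs.subspace_neg[OF sub]
  have "abelian_group (H p)"
  proof (rule abelian_groupI)
    show "\<zero>\<^bsub>H p\<^esub> \<in> carrier (H p)"
      unfolding zero_H carrier_H using Zc(1) by blast
  next
    fix x y assume "x \<in> carrier (H p)" "y \<in> carrier (H p)"
    then obtain z w where z: "z \<in> Z ?m" "x = hcoset ?m z" and w: "w \<in> Z ?m" "y = hcoset ?m w"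
      unfolding carrier_H by blast
    show "x \<oplus>\<^bsub>H p\<^esub> y \<in> carrier (H p)"
      unfolding z w add_H carrier_H using Zc(2)[OF z(1) w(1)] by blast
    show "x \<oplus>\<^bsub>H p\<^esub> y = y \<oplus>\<^bsub>H p\<^esub> x"
      unfolding z w add_H by (simp only: add.commute)
    fix v assume "v \<in> carrier (H p)"
    then obtain u where u: "v = hcoset ?m u"
      unfolding carrier_H by blast
    show "x \<oplus>\<^bsub>H p\<^esub> y \<oplus>\<^bsub>H p\<^esub> v = x \<oplus>\<^bsub>H p\<^esub> (y \<oplus>\<^bsub>H p\<^esub> v)"
      unfolding z w u add_H by (simp only: add.assoc)
  next
    fix x assume "x \<in> carrier (H p)"
    then obtain z where z: "z \<in> Z ?m" "x = hcoset ?m z"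
      unfolding carrier_H by blast
    show "\<zero>\<^bsub>H p\<^esub> \<oplus>\<^bsub>H p\<^esub> x = x"
      unfolding z zero_H add_H by simp
    have "hcoset ?m (- z) \<in> carrier (H p)"
      unfolding carrier_H using Zc(4)[OF z(1)] by blast
    moreover have "hcoset ?m (- z) \<oplus>\<^bsub>H p\<^esub> x = \<zero>\<^bsub>H p\<^esub>"
      unfolding z zero_H add_H by simp
    ultimately show "\<exists>y\<in>carrier (H p). y \<oplus>\<^bsub>H p\<^esub> x = \<zero>\<^bsub>H p\<^esub>" by blast
  qed
  moreover have "module_axioms (scalar_field :: 'k ring) (H p)"
  proof
    fix a b :: 'k and x y
    assume "x \<in> carrier (H p)"
    then obtain z where z: "z \<in> Z ?m" "x = hcoset ?m z" unfolding carrier_H by blast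
    show "a \<odot>\<^bsub>H p\<^esub> x \<in> carrier (H p)"
      unfolding z(2) smult_H carrier_H using z(1) Zc(3) by blast
    show "(a \<oplus>\<^bsub>scalar_field\<^esub> b) \<odot>\<^bsub>H p\<^esub> x = a \<odot>\<^bsub>H p\<^esub> x \<oplus>\<^bsub>H p\<^esub> b \<odot>\<^bsub>H p\<^esub> x"
      unfolding z(2) smult_H add_H by (simp add: fun_vs.scale_left_distrib)
    show "(a \<otimes>\<^bsub>scalar_field\<^esub> b) \<odot>\<^bsub>H p\<^esub> x = a \<odot>\<^bsub>H p\<^esub> (b \<odot>\<^bsub>H p\<^esub> x)"
      unfolding z(2) smult_H by simp
    show "\<one>\<^bsub>scalar_field\<^esub> \<odot>\<^bsub>H p\<^esub> x = x"
      unfolding z(2) smult_H by simp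
    assume "y \<in> carrier (H p)"
    then obtain w where w: "y = hcoset ?m w" unfolding carrier_H by blast
    show "a \<odot>\<^bsub>H p\<^esub> (x \<oplus>\<^bsub>H p\<^esub> y) = a \<odot>\<^bsub>H p\<^esub> x \<oplus>\<^bsub>H p\<^esub> a \<odot>\<^bsub>H p\<^esub> y"
      unfolding z(2) w smult_H add_H by (simp add: fun_vs.scale_right_distrib)
  qed
  ultimately have "Module.module scalar_field (H p)"
    by (intro module.intro cring_scalar)
  then show ?thesis
    using field_scalar by (rule vectorspace.intro)
qed

text \<open>The bridge between the two notions of span: the cycles whose class lies in the span of
  the classes of \<open>G\<close> form a subspace that contains \<open>B (Suc p)\<close> and
  \<open>G\<close>, hence all cycles.\<close>

lemma reduced_betti_le_card:
  assumes "finite G" "G \<subseteq> Z (Suc p)" "Z (Suc p) \<subseteq> fun_vs.span (B (Suc p) \<union> G)"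
  shows "reduced_betti F K p \<le> card G"
proof -
  interpret V: vectorspace "scalar_field :: 'k ring" "H p" by (rule vectorspace_H)
  let ?m = "Suc p"
  let ?A = "hcoset ?m ` G"
  have A: "?A \<subseteq> carrier (H p)"
    using assms(2) by (auto simp: carrier_H)
  have sub: "submodule scalar_field (V.span ?A) (H p)"
    using V.span_is_submodule[OF A] .
  have "fun_vs.subspace {z \<in> Z ?m. hcoset ?m z \<in> V.span ?A}"
    unfolding fun_vs.subspace_def
  proof (intro conjI ballI allI)
    show "0 \<in> {z \<in> Z ?m. hcoset ?m z \<in> V.span ?A}"
      using subspace_Z[THEN fun_vs.subspace_0] submodule.zero_closed[OF sub] by (simp add: zero_H)
  next
    fix x y assume "x \<in> {z \<in> Z ?m. hcoset ?m z \<in> V.span ?A}" "y \<in> {z \<in> Z ?m. hcoset ?m z \<in> V.span ?A}"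
    then show "x + y \<in> {z \<in> Z ?m. hcoset ?m z \<in> V.span ?A}"
      using fun_vs.subspace_add[OF subspace_Z, of x ?m y] submodule.m_closed[OF sub, of "hcoset ?m x" "hcoset ?m y"]
      by (simp add: add_H)
  next
    fix c x assume "x \<in> {z \<in> Z ?m. hcoset ?m z \<in> V.span ?A}"
    then show "fscale c x \<in> {z \<in> Z ?m. hcoset ?m z \<in> V.span ?A}"
      using fun_vs.subspace_scale[OF subspace_Z, of x ?m c] submodule.smult_closed[OF sub, of c "hcoset ?m x"]
      by (simp add: smult_H)
  qed
  moreover have "B ?m \<union> G \<subseteq> {z \<in> Z ?m. hcoset ?m z \<in> V.span ?A}"
  proof -
    have "hcoset ?m b = hcoset ?m 0" if "b \<in> B ?m" for b
      using that by (simp add: hcoset_eq_iff)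
    moreover have "hcoset ?m 0 \<in> V.span ?A"
      using submodule.zero_closed[OF sub] by (simp add: zero_H)
    ultimately show ?thesis
      using B_subset_Z assms(2) V.in_own_span[OF A] by auto
  qed
  ultimately have "Z ?m \<subseteq> {z \<in> Z ?m. hcoset ?m z \<in> V.span ?A}"
    using assms(3) fun_vs.span_minimal by blast
  then have "carrier (H p) \<subseteq> V.span ?A"
    unfolding carrier_H by blast
  then have "V.gen_set ?A"
    using submodule.subset[OF sub] by (rule antisym[rotated])
  then have "V.dim \<le> card ?A"
    using V.gen_ge_dim assms(1) A by blast
  then show ?thesis
    using card_image_le[OF assms(1), of "hcoset ?m"] by (simp add: reduced_betti_def)
qed

end

section \<open>Clearing triangles\<close>

context finite_complex
begin

definition triangles :: "'v set set"
  where "triangles = {t \<in> K. card t = 3}"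

definition carried :: "'v set set \<Rightarrow> ('v list \<Rightarrow> 'k) set"
  where "carried X = {z \<in> Z 3. \<forall>xs. z xs \<noteq> 0 \<longrightarrow> set xs \<in> X}"

text \<open>Cycles are counted modulo the boundaries of the whole complex, and \<open>G\<close> may
  leave \<open>carried X\<close>. So the property passes to smaller \<open>X\<close>, and order of
  insertion is free. The 3 counts vertices.\<close>

definition gens :: "'v set set \<Rightarrow> nat \<Rightarrow> bool"
  where "gens X N \<longleftrightarrow> (\<exists>G. finite G \<and> card G \<le> N \<and> G \<subseteq> Z 3 \<and>
    carried X \<subseteq> fun_vs.span (B 3 \<union> G))"

lemma gens_if_carried_subset:
  "gens X N \<Longrightarrow> carried Y \<subseteq> carried X \<Longrightarrow> N \<le> M \<Longrightarrow> gens Y M"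
  unfolding gens_def by (meson order_trans)

lemma gens_mono: "gens X N \<Longrightarrow> Y \<subseteq> X \<Longrightarrow> N \<le> M \<Longrightarrow> gens Y M"
  by (rule gens_if_carried_subset[of X N Y M]) (auto simp: carried_def)

lemma gens_empty: "gens {} 0"
proof -
  have "carried {} \<subseteq> {0}"
    by (auto simp: carried_def)
  then have "carried {} \<subseteq> fun_vs.span (B 3 \<union> {})"
    using fun_vs.span_zero by blast
  then show ?thesis
    unfolding gens_def by (intro exI[of _ "{}"]) simp
qed

lemma cycle_set_triangle:
  assumes "z \<in> Z 3" "z xs \<noteq> 0"
  shows "set xs \<in> triangles"
proof -
  have "distinct xs" "length xs = 3" "set xs \<in> K"
    using assms chain_supportD[of z K 3 xs] by (auto simp: Z_iff)
  then show ?thesis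
    by (simp add: triangles_def distinct_card)
qed

lemma reduced_betti_le_if_gens:
  assumes "gens X N" "triangles \<subseteq> X"
  shows "reduced_betti F K 2 \<le> N"
proof -
  obtain G where G: "finite G" "card G \<le> N" "G \<subseteq> Z 3" "carried X \<subseteq> fun_vs.span (B 3 \<union> G)"
    using assms(1) by (auto simp: gens_def)
  have "Z 3 \<subseteq> carried X"
    using cycle_set_triangle assms(2) by (auto simp: carried_def)
  moreover have "Suc 2 = 3" by simp
  ultimately have "reduced_betti F K 2 \<le> card G"
    using reduced_betti_le_card[of G 2] G by (metis subset_trans)
  then show ?thesis using G(2) by simp
qed

text \<open>One step of Gaussian elimination with pivot \<open>g\<close>: the coefficient is killed
  at one ordering of \<open>t\<close>, and by alternation at all of them.\<close>

lemma eliminate: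
  assumes z: "z \<in> carried (insert t X)" and g: "g \<in> carried (insert t X)"
    and xs: "distinct xs" "set xs = t" "g xs \<noteq> 0"
  shows "z - fscale (z xs / g xs) g \<in> carried X"
proof -
  let ?w = "z - fscale (z xs / g xs) g"
  have w: "?w \<in> Z 3"
    using z g fun_vs.subspace_diff[OF subspace_Z] fun_vs.subspace_scale[OF subspace_Z]
    by (auto simp: carried_def)
  have "set ys \<in> X" if ys: "?w ys \<noteq> 0" for ys
  proof (cases "set ys = t")
    case True
    have "?w xs = 0" using xs by simp
    moreover have "distinct ys"
      using w ys chain_supportD(1)[of ?w K 3 ys] by (auto simp: Z_iff)
    ultimately have "?w ys = 0"
      using w xs True by (intro zero_same_set[of ?w K 3 xs ys]) (auto simp: Z_iff)
    then show ?thesis using ys by blast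
  next
    case False
    have "z ys \<noteq> 0 \<or> g ys \<noteq> 0"
      using ys by auto
    then show ?thesis
      using False z g by (auto simp: carried_def)
  qed
  then show ?thesis
    using w by (simp add: carried_def)
qed

text \<open>If \<open>t\<close> allows any new cycle, one such cycle is added to the generators and
  serves as pivot for all others.\<close>

lemma gens_insert_critical:
  assumes "gens X N"
  shows "gens (insert t X) (Suc N)"
proof (cases "carried (insert t X) \<subseteq> carried X")
  case True
  then show ?thesis using assms gens_if_carried_subset by (meson le_SucI order_refl)
next
  case False
  then obtain g where g: "g \<in> carried (insert t X)" "g \<notin> carried X" by blast
  then obtain xs where xs: "g xs \<noteq> 0" "set xs \<notin> X"
    by (auto simp: carried_def)
  then have t: "set xs = t" "distinct xs"
    using g chain_supportD(1)[of g K 3 xs] by (auto simp: carried_def Z_iff)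
  obtain G where G: "finite G" "card G \<le> N" "G \<subseteq> Z 3" "carried X \<subseteq> fun_vs.span (B 3 \<union> G)"
    using assms by (auto simp: gens_def)
  have "z \<in> fun_vs.span (B 3 \<union> insert g G)" if z: "z \<in> carried (insert t X)" for z
  proof -
    have "z - fscale (z xs / g xs) g \<in> fun_vs.span (B 3 \<union> insert g G)"
      using eliminate[OF z g(1) t(2,1) xs(1)] G(4) fun_vs.span_mono[of "B 3 \<union> G" "B 3 \<union> insert g G"]
      by blast
    moreover have "fscale (z xs / g xs) g \<in> fun_vs.span (B 3 \<union> insert g G)"
      by (intro fun_vs.span_scale fun_vs.span_base) simp
    ultimately show ?thesis
      using fun_vs.span_add by fastforce
  qed
  then show ?thesis
    unfolding gens_def using G g(1)
    by (intro exI[of _ "insert g G"]) (auto simp: carried_def card_insert_if)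
qed

text \<open>Only the fourth vertex can be put in front of an ordering of the face \<open>t\<close>,
  so the sum that defines the boundary there has a single term, which is nonzero.\<close>

lemma tetrahedron_boundary:
  assumes "\<tau> \<in> K" "card \<tau> = 4" "t \<subseteq> \<tau>" "card t = 3" "distinct xs" "set xs = t"
  obtains b where "b \<in> B 3" "b xs \<noteq> 0" "\<And>ys. b ys \<noteq> 0 \<Longrightarrow> set ys \<subseteq> \<tau>"
proof -
  have fin: "finite \<tau>" using assms(2) card.infinite by fastforce
  then obtain ts where ts: "set ts = \<tau>" "distinct ts"
    using finite_distinct_list by blast
  have len: "length ts = 4" using ts assms(2) distinct_card by fastforce
  define e where "e = (elem_chain ts :: 'v list \<Rightarrow> 'k)"
  have e: "e \<in> carrier (chain_space K 4)"
    using elem_chain_in_chain_space[of ts K] ts assms(1) len by (simp add: e_def)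
  have es: "set ys = \<tau>" if "e ys \<noteq> 0" for ys
    using that ts unfolding e_def by (auto dest!: elem_chain_support)
  have "card (\<tau> - t) = 1"
    using assms fin by (simp add: card_Diff_subset finite_subset)
  then obtain x where x: "\<tau> - t = {x}" by (auto simp: card_1_singleton_iff)
  have xK: "x \<in> \<Union>K" using x assms(1) by blast
  have "e (v # xs) = 0" if "v \<noteq> x" for v
  proof (rule ccontr)
    assume "e (v # xs) \<noteq> 0"
    then have "set (v # xs) = \<tau>" by (rule es)
    then have "insert v t = \<tau>" using assms(6) by simp
    moreover have "x \<in> \<tau> - t" using x by simp
    ultimately show False using that by (metis Diff_iff insertE)
  qed
  then have "boundary K e xs = (\<Sum>v\<in>{x}. e (v # xs))"
    unfolding boundary_def using finite_vertices xK by (intro sum.mono_neutral_right) auto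
  then have "boundary K e xs = e (x # xs)" by simp
  moreover have "e (x # xs) \<noteq> 0"
    unfolding e_def by (rule elem_chain_nonzero) (use ts x assms in auto)
  ultimately have nz: "boundary K e xs \<noteq> 0" by metis
  have "set ys \<subseteq> \<tau>" if nzy: "boundary K e ys \<noteq> 0" for ys
  proof -
    obtain v where "e (v # ys) \<noteq> 0"
      using nzy unfolding boundary_def by (meson sum.not_neutral_contains_not_neutral)
    then have "set (v # ys) = \<tau>" by (rule es)
    then show ?thesis by auto
  qed
  moreover have "boundary K e \<in> B 3"
    using e by (auto simp: B_def boundaries_def numeral_eq_Suc)
  ultimately show ?thesis using that nz by blast
qed

text \<open>The pivot for \<open>eliminate\<close> is now the boundary of \<open>\<tau>\<close>,
  which lies in \<open>B 3\<close> and costs nothing.\<close>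

lemma gens_insert_up:
  assumes "gens X N" "\<tau> \<in> K" "card \<tau> = 4" "t \<subseteq> \<tau>" "card t = 3"
    "\<And>s. s \<subseteq> \<tau> \<Longrightarrow> card s = 3 \<Longrightarrow> s \<noteq> t \<Longrightarrow> s \<in> X"
  shows "gens (insert t X) N"
proof -
  have "finite t" using assms(5) card.infinite by fastforce
  then obtain xs where xs: "set xs = t" "distinct xs"
    using finite_distinct_list by blast
  obtain b where b: "b \<in> B 3" "b xs \<noteq> 0" "\<And>ys. b ys \<noteq> 0 \<Longrightarrow> set ys \<subseteq> \<tau>"
    using tetrahedron_boundary[OF assms(2-5) xs(2,1)] by blast
  have bZ: "b \<in> Z 3" using b(1) B_subset_Z by blast
  have bc: "b \<in> carried (insert t X)"
    unfolding carried_def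
  proof (intro CollectI conjI allI impI bZ)
    fix ys assume nz: "b ys \<noteq> 0"
    have "card (set ys) = 3"
      using cycle_set_triangle[OF bZ nz] by (simp add: triangles_def)
    then show "set ys \<in> insert t X"
      using assms(6)[of "set ys"] b(3)[OF nz] by blast
  qed
  obtain G where G: "finite G" "card G \<le> N" "G \<subseteq> Z 3" "carried X \<subseteq> fun_vs.span (B 3 \<union> G)"
    using assms(1) by (auto simp: gens_def)
  have "z \<in> fun_vs.span (B 3 \<union> G)" if z: "z \<in> carried (insert t X)" for z
  proof -
    have "z - fscale (z xs / b xs) b \<in> fun_vs.span (B 3 \<union> G)"
      using eliminate[OF z bc xs(2,1) b(2)] G(4) by blast
    moreover have "fscale (z xs / b xs) b \<in> fun_vs.span (B 3 \<union> G)"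
      using b(1) by (intro fun_vs.span_scale fun_vs.span_base) simp
    ultimately show ?thesis
      using fun_vs.span_add by fastforce
  qed
  then show ?thesis
    unfolding gens_def using G by blast
qed

text \<open>The previous lemma with named vertices: \<open>d\<close> is the apex over the new
  triangle, and the three faces at \<open>d\<close> are already cleared.\<close>

lemma gens_insert_face:
  assumes "gens X N" "distinct [a, b, c, d]" "{a, b, c, d} \<in> K"
    "{b, c, d} \<in> X" "{a, c, d} \<in> X" "{a, b, d} \<in> X"
  shows "gens (insert {a, b, c} X) N"
proof (rule gens_insert_up[OF assms(1,3)])
  fix s assume s: "s \<subseteq> {a, b, c, d}" "card s = 3" "s \<noteq> {a, b, c}"
  have "card ({a, b, c, d} - s) = 1"
    using assms(2) s(1,2) by (subst card_Diff_subset) (auto intro: finite_subset)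
  then obtain x where "{a, b, c, d} - s = {x}" by (auto simp: card_1_singleton_iff)
  then have "s = {a, b, c, d} - {x}" "x \<in> {a, b, c, d}" using s(1) by auto
  then have "s = {b, c, d} \<or> s = {a, c, d} \<or> s = {a, b, d} \<or> s = {a, b, c}"
    using assms(2) by auto
  then show "s \<in> X" using s(3) assms by auto
qed (use assms(2) in auto)

text \<open>The boundary coefficient of a cycle at the edge \<open>{a, b}\<close> is, up to sign,
  its coefficient at the only triangle on that edge. So no cycle uses a triangle of
  \<open>Y\<close>.\<close>

lemma gens_Un_down:
  assumes "gens X N"
    and down: "\<And>t. t \<in> Y \<Longrightarrow> \<exists>x a b. t = {x, a, b} \<and> x \<noteq> a \<and> x \<noteq> b \<and> a \<noteq> b \<and>
      (\<forall>s\<in>X \<union> Y. {a, b} \<subseteq> s \<longrightarrow> s = t)"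
  shows "gens (X \<union> Y) N"
proof (rule gens_if_carried_subset[OF assms(1)])
  have "set xs \<notin> Y" if z: "z \<in> carried (X \<union> Y)" and nz: "z xs \<noteq> 0" for z xs
  proof
    assume "set xs \<in> Y"
    then obtain x a b where t: "set xs = {x, a, b}" "x \<noteq> a" "x \<noteq> b" "a \<noteq> b"
      "\<And>s. s \<in> X \<union> Y \<Longrightarrow> {a, b} \<subseteq> s \<Longrightarrow> s = set xs"
      using down by metis
    have zc: "z \<in> carrier (chain_space K 3)" and bz: "boundary K z = 0"
      using z by (auto simp: carried_def Z_iff)
    have "z [v, a, b] = 0" if "v \<noteq> x" for v
    proof (rule ccontr)
      assume nzv: "z [v, a, b] \<noteq> 0"
      then have "set [v, a, b] \<in> X \<union> Y" using z by (auto simp: carried_def)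
      then have "set [v, a, b] = {x, a, b}" using t(1) t(5)[of "set [v, a, b]"] by simp
      moreover have "distinct [v, a, b]" using chain_supportD(1)[OF zc nzv] .
      ultimately show False using that by auto
    qed
    moreover have "x \<in> \<Union>K"
      using chain_supportD(3)[OF zc nz] t(1) by blast
    ultimately have "boundary K z [a, b] = (\<Sum>v\<in>{x}. z [v, a, b])"
      unfolding boundary_def using finite_vertices by (intro sum.mono_neutral_right) auto
    then have "z [x, a, b] = 0" using bz by simp
    then have "z xs = 0"
      using t chain_supportD(1)[OF zc nz] by (intro zero_same_set[OF zc, of "[x, a, b]" xs]) auto
    then show False using nz by blast
  qed
  then show "carried (X \<union> Y) \<subseteq> carried X"
    by (auto simp: carried_def)
qed simp

lemma gens_insert_down:
  assumes "gens X N" "distinct [x, a, b]" "\<And>s. s \<in> X \<Longrightarrow> \<not> {a, b} \<subseteq> s"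
  shows "gens (insert {a, b, x} X) N"
proof -
  have "gens (X \<union> {{a, b, x}}) N"
  proof (rule gens_Un_down[OF assms(1)])
    fix t assume "t \<in> {{a, b, x}}"
    then have "t = {x, a, b} \<and> x \<noteq> a \<and> x \<noteq> b \<and> a \<noteq> b \<and>
      (\<forall>s\<in>X \<union> {{a, b, x}}. {a, b} \<subseteq> s \<longrightarrow> s = t)"
      using assms(2,3) by auto
    then show "\<exists>x' a' b'. t = {x', a', b'} \<and> x' \<noteq> a' \<and> x' \<noteq> b' \<and> a' \<noteq> b' \<and>
      (\<forall>s\<in>X \<union> {{a, b, x}}. {a', b'} \<subseteq> s \<longrightarrow> s = t)" by blast
  qed
  then show ?thesis by simp
qed

text \<open>The vertex \<open>r\<close> is a hub: each \<open>{u, v, x}\<close> is pushed across the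
  tetrahedron \<open>{u, v, x, r}\<close>.\<close>

lemma gens_star:
  assumes "gens X N" "finite L" "{u, v, r} \<in> X"
    and step: "\<And>x. x \<in> L \<Longrightarrow> x \<noteq> r \<Longrightarrow> distinct [u, v, x, r] \<and> {u, v, x, r} \<in> K \<and>
      {u, x, r} \<in> X \<and> {v, x, r} \<in> X"
  shows "gens (X \<union> (\<lambda>x. {u, v, x}) ` L) N"
proof -
  have "gens (X \<union> (\<lambda>x. {u, v, x}) ` M) N" if "M \<subseteq> L" for M
    using finite_subset[OF that assms(2)] that
  proof (induction M rule: finite_induct)
    case empty
    then show ?case using assms(1) by simp
  next
    case (insert x M)
    then have IH: "gens (X \<union> (\<lambda>x. {u, v, x}) ` M) N" by blast
    show ?case
    proof (cases "x = r")
      case True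
      then show ?thesis using IH assms(3) by (simp add: insert_absorb)
    next
      case False
      then have "distinct [u, v, x, r] \<and> {u, v, x, r} \<in> K \<and> {u, x, r} \<in> X \<and> {v, x, r} \<in> X"
        using step insert.prems by blast
      then show ?thesis
        using gens_insert_face[OF IH, of u v x r] assms(3) by simp
    qed
  qed
  then show ?thesis by blast
qed

end

section \<open>Clique complexes with a partition into cliques\<close>

lemma card_3_with:
  assumes "card t = 3" "x \<in> t"
  obtains a b where "t = {x, a, b}" "x \<noteq> a" "x \<noteq> b" "a \<noteq> b"
proof -
  have "finite t" using assms(1) card.infinite by fastforce
  then have "card (t - {x}) = 2" using assms by simp
  then obtain a b where "t - {x} = {a, b}" "a \<noteq> b" by (auto simp: card_2_iff)
  moreover from this have "t = {x, a, b}" "x \<noteq> a" "x \<noteq> b" using assms(2) by auto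
  ultimately show ?thesis using that by blast
qed

lemma card_3_with2:
  assumes "card t = 3" "x \<in> t" "y \<in> t" "x \<noteq> y"
  obtains a where "t = {x, y, a}" "x \<noteq> a" "y \<noteq> a"
proof -
  obtain a b where t: "t = {x, a, b}" "x \<noteq> a" "x \<noteq> b" "a \<noteq> b"
    using card_3_with[OF assms(1,2)] by blast
  then consider "y = a" | "y = b" using assms by blast
  then show ?thesis
    by cases (use that[of b] that[of a] t in auto)
qed

locale cell_complex =
  fixes S :: "'v set" and adj :: "'v \<Rightarrow> 'v \<Rightarrow> bool" and cell :: "'v \<Rightarrow> 'c" and F :: "'k::field itself"
  assumes finite_S: "finite S"
    and adj_sym: "adj x y \<Longrightarrow> adj y x"
    and adj_cell: "x \<in> S \<Longrightarrow> y \<in> S \<Longrightarrow> cell x = cell y \<Longrightarrow> adj x y"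
begin

definition cliques :: "'v set set"
  where "cliques = {\<sigma>. \<sigma> \<subseteq> S \<and> (\<forall>x\<in>\<sigma>. \<forall>y\<in>\<sigma>. adj x y)}"

sublocale finite_complex cliques F
proof
  have "\<Union>cliques \<subseteq> S" by (auto simp: cliques_def)
  then show "finite (\<Union>cliques)" by (rule finite_subset[OF _ finite_S])
  show "\<tau> \<in> cliques" if "\<sigma> \<in> cliques" "\<tau> \<subseteq> \<sigma>" for \<sigma> \<tau>
    using that by (auto simp: cliques_def)
qed

lemma adj_refl: "x \<in> S \<Longrightarrow> adj x x"
  using adj_cell by blast

lemma triangles_iff: "t \<in> triangles \<longleftrightarrow> t \<subseteq> S \<and> (\<forall>x\<in>t. \<forall>y\<in>t. adj x y) \<and> card t = 3"
  unfolding triangles_def unfolding cliques_def by auto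

lemma finite_triangles: "finite triangles"
proof -
  have "triangles \<subseteq> Pow S" by (auto simp: triangles_iff)
  then show ?thesis by (rule finite_subset) (simp add: finite_S)
qed

lemma triangleD:
  assumes "t \<in> triangles"
  shows "card t = 3" "t \<subseteq> S" "\<And>x y. x \<in> t \<Longrightarrow> y \<in> t \<Longrightarrow> adj x y"
  using assms by (auto simp: triangles_iff)

lemma triangleI:
  assumes "x \<in> S" "y \<in> S" "z \<in> S" "distinct [x, y, z]" "adj x y" "adj x z" "adj y z"
  shows "{x, y, z} \<in> triangles"
  using assms adj_sym adj_refl by (auto simp: triangles_iff)

lemma clique4I:
  assumes "w \<in> S" "x \<in> S" "y \<in> S" "z \<in> S"
    "adj w x" "adj w y" "adj w z" "adj x y" "adj x z" "adj y z"
  shows "{w, x, y, z} \<in> cliques"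
  using assms adj_sym adj_refl by (auto simp: cliques_def)

section \<open>Triangles in one cell\<close>

definition mono_triangles :: "'v set set"
  where "mono_triangles = {t \<in> triangles. \<exists>c. cell ` t = {c}}"

text \<open>A cell spans a full simplex, a cone with chosen apex \<open>b c\<close>. Triangles at
  the apex have their opposite edge free among \<open>Y\<close>; every other triangle is pushed
  across the tetrahedron with that apex.\<close>

lemma gens_mono_triangles: "gens mono_triangles 0"
proof -
  define b where "b c = (SOME x. x \<in> S \<and> cell x = c)" for c
  have b: "b (cell x) \<in> S" "cell (b (cell x)) = cell x" if "x \<in> S" for x
    using someI[of "\<lambda>y. y \<in> S \<and> cell y = cell x" x] that by (auto simp: b_def)
  define Y where "Y = {t \<in> triangles. \<exists>c. cell ` t = {c} \<and> b c \<in> t}"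
  have "gens ({} \<union> Y) 0"
  proof (rule gens_Un_down[OF gens_empty])
    fix t assume t: "t \<in> Y"
    then obtain c where c: "cell ` t = {c}" "b c \<in> t" and tt: "t \<in> triangles"
      by (auto simp: Y_def)
    obtain a d where ad: "t = {b c, a, d}" "b c \<noteq> a" "b c \<noteq> d" "a \<noteq> d"
      using card_3_with[OF triangleD(1)[OF tt] c(2)] by blast
    have "s = t" if s: "s \<in> {} \<union> Y" "{a, d} \<subseteq> s" for s
    proof -
      obtain c' where c': "cell ` s = {c'}" "b c' \<in> s" and ss: "s \<in> triangles"
        using s by (auto simp: Y_def)
      \<comment> \<open>The edge \<open>{a, d}\<close> fixes the cell, hence the apex, hence the
        triangle.\<close>
      have "a \<in> s" "a \<in> t" using s ad by auto
      then have "c' = c" using c(1) c'(1) by (metis image_eqI singletonD)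
      then have "t \<subseteq> s" using ad s c' by auto
      moreover have "finite s" using triangleD(1)[OF ss] card.infinite by fastforce
      ultimately show ?thesis
        using card_subset_eq[of s t] triangleD(1)[OF ss] triangleD(1)[OF tt] by simp
    qed
    then show "\<exists>x a b. t = {x, a, b} \<and> x \<noteq> a \<and> x \<noteq> b \<and> a \<noteq> b \<and>
      (\<forall>s\<in>{} \<union> Y. {a, b} \<subseteq> s \<longrightarrow> s = t)"
      using ad by blast
  qed
  then have Y0: "gens Y 0" by simp
  have fin_mono: "finite mono_triangles"
    using finite_triangles by (simp add: mono_triangles_def)
  have "gens (Y \<union> M) 0" if "M \<subseteq> mono_triangles" for M
    using finite_subset[OF that fin_mono] that
  proof (induction M rule: finite_induct)
    case empty
    then show ?case using Y0 by simp
  next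
    case (insert t M)
    then have IH: "gens (Y \<union> M) 0" by blast
    from insert.prems obtain c where c: "cell ` t = {c}" and tt: "t \<in> triangles"
      by (auto simp: mono_triangles_def)
    show ?case
    proof (cases "t \<in> Y")
      case True
      then show ?thesis using IH by (simp add: insert_absorb)
    next
      case False
      then have nb: "b c \<notin> t" using c tt by (auto simp: Y_def)
      obtain x y z where xyz: "t = {x, y, z}" "x \<noteq> y" "x \<noteq> z" "y \<noteq> z"
        using triangleD(1)[OF tt] by (auto simp: card_3_iff)
      have S: "x \<in> S" "y \<in> S" "z \<in> S" using triangleD(2)[OF tt] xyz by auto
      have cc: "cell x = c" "cell y = c" "cell z = c" using c xyz by auto
      have bc: "b c \<in> S" "cell (b c) = c" using b[OF S(1)] cc by auto
      have in_Y: "{p, q, b c} \<in> Y" if "p \<in> t" "q \<in> t" "p \<noteq> q" for p q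
      proof -
        have "p \<in> S" "q \<in> S" "cell p = c" "cell q = c" "p \<noteq> b c" "q \<noteq> b c"
          using that S cc xyz nb by auto
        then have "{p, q, b c} \<in> triangles"
          using that bc by (intro triangleI adj_cell) auto
        moreover have "cell ` {p, q, b c} = {c}"
          using \<open>cell p = c\<close> \<open>cell q = c\<close> bc by auto
        ultimately show ?thesis unfolding Y_def by blast
      qed
      have "{x, y, z, b c} \<in> cliques"
        using S bc cc by (intro clique4I adj_cell) auto
      then have "gens (insert {x, y, z} (Y \<union> M)) 0"
        using xyz nb in_Y by (intro gens_insert_face[OF IH, of x y z "b c"]) auto
      then show ?thesis using xyz(1) by simp
    qed
  qed
  from this[OF order_refl] show ?thesis
    by (rule gens_mono) auto
qed

section \<open>Triangles in two cells\<close>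

definition pair_triangles :: "'c \<Rightarrow> 'c \<Rightarrow> 'v set \<Rightarrow> 'v set set"
  where "pair_triangles c d Q =
    {t \<in> triangles. cell ` t = {c, d} \<and> (\<forall>x\<in>t. cell x = d \<longrightarrow> x \<in> Q)}"

text \<open>Insertion runs in two loops: \<open>Q\<close> grows by a point \<open>v\<close> of
  \<open>d\<close>, and meanwhile the neighbours of \<open>v\<close> in \<open>c\<close> join
  \<open>A\<close> one by one.\<close>

definition pair_star :: "'c \<Rightarrow> 'c \<Rightarrow> 'v set \<Rightarrow> 'v \<Rightarrow> 'v set \<Rightarrow> 'v set set"
  where "pair_star c d Q v A =
    {t \<in> pair_triangles c d (insert v Q). v \<in> t \<and> (\<forall>x\<in>t. cell x = c \<longrightarrow> x \<in> A)}"

text \<open>Adding the edge \<open>uv\<close> adds a triangle for each common neighbour. Those in \<open>Q\<close> form a clique, and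
  so do those in \<open>A\<close>, so a generator is needed only if both are nonempty and not joined.\<close>

lemma gens_pair_star_insert:
  fixes X Q A c d v
  defines "Y \<equiv> \<lambda>A. X \<union> pair_triangles c d Q \<union> pair_star c d Q v A"
  assumes cd: "c \<noteq> d"
    and X: "mono_triangles \<subseteq> X" "\<And>t. t \<in> X \<Longrightarrow> \<not> {c, d} \<subseteq> cell ` t"
    and v: "v \<in> S" "cell v = d" "v \<notin> Q" and Q: "Q \<subseteq> {x \<in> S. cell x = d}"
    and A: "A \<subseteq> {x \<in> S. cell x = c \<and> adj x v}"
    and u: "u \<in> S" "cell u = c" "adj u v" "u \<notin> A"
    and Y: "gens (Y A) N"
    and NM: "N \<le> M"
      "(\<exists>x\<in>Q. adj u x) \<Longrightarrow> A \<noteq> {} \<Longrightarrow> \<not> (\<exists>x\<in>Q. \<exists>a\<in>A. adj u x \<and> adj a x) \<Longrightarrow> Suc N \<le> M"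
  shows "gens (Y (insert u A)) M"
proof -
  define L1 where "L1 = {x \<in> Q. adj u x}"
  let ?f = "\<lambda>x. {u, v, x}"
  have fin: "finite L1" "finite A"
    using Q A finite_S by (auto simp: L1_def intro: finite_subset[of _ S])
  have sub: "Y (insert u A) \<subseteq> Y A \<union> ?f ` (L1 \<union> A)"
  proof
    fix t assume t: "t \<in> Y (insert u A)"
    show "t \<in> Y A \<union> ?f ` (L1 \<union> A)"
    proof (cases "t \<in> X \<union> pair_triangles c d Q \<or> u \<notin> t")
      case True
      then show ?thesis using t by (auto simp: Y_def pair_star_def)
    next
      case False
      then have ts: "t \<in> triangles" "cell ` t = {c, d}" "v \<in> t" "u \<in> t"
        and tc: "\<forall>x\<in>t. cell x = d \<longrightarrow> x \<in> insert v Q" "\<forall>x\<in>t. cell x = c \<longrightarrow> x \<in> insert u A"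
        using t by (auto simp: Y_def pair_star_def pair_triangles_def)
      have "u \<noteq> v" using cd u v by auto
      then obtain x where x: "t = {u, v, x}" "u \<noteq> x" "v \<noteq> x"
        using card_3_with2[OF triangleD(1)[OF ts(1)] ts(4,3)] by blast
      have "cell x = c \<or> cell x = d" using ts(2) x by auto
      then have "x \<in> L1 \<union> A"
      proof
        assume "cell x = c"
        then show ?thesis using tc x by auto
      next
        assume "cell x = d"
        then have "x \<in> Q" using tc x by auto
        moreover have "adj u x" using triangleD(3)[OF ts(1)] x by auto
        ultimately show ?thesis by (auto simp: L1_def)
      qed
      then show ?thesis using x(1) by blast
    qed
  qed
  have not_in: "\<not> {u, v} \<subseteq> s" if "s \<in> Y A" for s
  proof
    assume uv: "{u, v} \<subseteq> s"
    then have "{c, d} \<subseteq> cell ` s" using u v by blast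
    then show False
      using that X(2) uv u v by (auto simp: Y_def pair_star_def pair_triangles_def)
  qed
  have Lcell: "x \<in> S \<and> adj u x \<and> adj v x \<and> x \<noteq> u \<and> x \<noteq> v" if "x \<in> L1 \<union> A" for x
  proof (cases "x \<in> A")
    case True
    then have "x \<in> S" "cell x = c" "adj x v" using A by auto
    then show ?thesis
      using u v cd True adj_sym adj_cell[of u x] by auto
  next
    case False
    then have "x \<in> S" "cell x = d" "adj u x" "x \<in> Q" using that Q by (auto simp: L1_def)
    then show ?thesis
      using u v cd adj_cell[of v x] by auto
  qed
  \<comment> \<open>Two adjacent common neighbours of \<open>u\<close> and \<open>v\<close> supply
    what \<open>gens_star\<close> asks: a tetrahedron whose faces \<open>{u, x, r}\<close> and
    \<open>{v, x, r}\<close> are already cleared.\<close>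
  have nice: "distinct [u, v, x, r] \<and> {u, v, x, r} \<in> cliques \<and> {u, x, r} \<in> Y A \<and> {v, x, r} \<in> Y A"
    if xr: "x \<in> L1 \<union> A" "r \<in> L1 \<union> A" "x \<noteq> r" "adj x r" for x r
  proof -
    have xc: "x \<in> S" "adj u x" "adj v x" "x \<noteq> u" "x \<noteq> v" using Lcell[OF xr(1)] by auto
    have rc: "r \<in> S" "adj u r" "adj v r" "r \<noteq> u" "r \<noteq> v" using Lcell[OF xr(2)] by auto
    have uvn: "u \<noteq> v" using cd u v by auto
    have cl: "{u, v, x, r} \<in> cliques"
      using xc rc u v xr by (intro clique4I) auto
    have tu: "{u, x, r} \<in> triangles" and tv: "{v, x, r} \<in> triangles"
      using xc rc u v xr by (auto intro!: triangleI)
    have mono: "t \<in> Y A" if "t \<in> triangles" "cell ` t = {e}" for t e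
      using that X(1) by (auto simp: Y_def mono_triangles_def)
    have pairI: "t \<in> Y A" if "t \<in> triangles" "cell ` t = {c, d}" "\<forall>x\<in>t. cell x = d \<longrightarrow> x \<in> Q" for t
      using that by (auto simp: Y_def pair_triangles_def)
    have starI: "t \<in> Y A" if "t \<in> triangles" "cell ` t = {c, d}" "v \<in> t"
      "\<forall>x\<in>t. cell x = d \<longrightarrow> x \<in> insert v Q" "\<forall>x\<in>t. cell x = c \<longrightarrow> x \<in> A" for t
      using that by (auto simp: Y_def pair_triangles_def pair_star_def)
    have xcase: "x \<in> Q \<and> cell x = d \<or> x \<in> A \<and> cell x = c" using xr(1) A Q by (auto simp: L1_def)
    have rcase: "r \<in> Q \<and> cell r = d \<or> r \<in> A \<and> cell r = c" using xr(2) A Q by (auto simp: L1_def)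
    have "{u, x, r} \<in> Y A"
    proof (cases "cell x = c \<and> cell r = c")
      case True
      then show ?thesis using u by (intro mono[OF tu, of c]) auto
    next
      case False
      then show ?thesis using u xcase rcase cd by (intro pairI[OF tu]) auto
    qed
    moreover have "{v, x, r} \<in> Y A"
    proof (cases "cell x = d \<and> cell r = d")
      case True
      then show ?thesis using v by (intro mono[OF tv, of d]) auto
    next
      case False
      then show ?thesis using v xcase rcase cd by (intro starI[OF tv]) auto
    qed
    ultimately show ?thesis using cl xc rc xr uvn by auto
  qed
  \<comment> \<open>The edge \<open>uv\<close> is new, so the first triangle on it is free.\<close>
  have start: "gens (insert (?f r) (Y A)) N" if "r \<in> L1 \<union> A" for r
    using Lcell[OF that] not_in cd u v by (intro gens_insert_down[OF Y]) auto
  have adjL1: "adj x r" if "x \<in> L1" "r \<in> L1" for x r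
    using that Q by (intro adj_cell) (auto simp: L1_def)
  have adjA: "adj x r" if "x \<in> A" "r \<in> A" for x r
    using that A by (intro adj_cell) auto
  have star: "gens (W \<union> ?f ` L) n"
    if "gens W n" "Y A \<subseteq> W" "r \<in> L1 \<union> A" "?f r \<in> W" "L \<subseteq> L1 \<union> A" "\<And>x. x \<in> L \<Longrightarrow> adj x r" for W n r L
  proof (rule gens_star[OF that(1) _ that(4)])
    show "finite L" using that(5) by (rule finite_subset) (simp add: fin)
    fix x assume "x \<in> L" "x \<noteq> r"
    then show "distinct [u, v, x, r] \<and> {u, v, x, r} \<in> cliques \<and> {u, x, r} \<in> W \<and> {v, x, r} \<in> W"
      using nice[of x r] that by blast
  qed
  have "gens (Y A \<union> ?f ` (L1 \<union> A)) M"
  proof (cases "L1 = {}")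
    case True
    show ?thesis
    proof (cases "A = {}")
      case True
      then show ?thesis using \<open>L1 = {}\<close> gens_mono[OF Y _ NM(1)] by simp
    next
      case False
      then obtain a where a: "a \<in> A" by blast
      have "gens (insert (?f a) (Y A) \<union> ?f ` A) N"
        by (rule star[OF start, of a a]) (use a adjA in auto)
      then show ?thesis by (rule gens_mono) (use NM \<open>L1 = {}\<close> in auto)
    qed
  next
    case False
    then obtain x0 where x0: "x0 \<in> L1" by blast
    show ?thesis
    proof (cases "\<exists>x\<in>Q. \<exists>a\<in>A. adj u x \<and> adj a x")
      case True
      then obtain x a where xa: "x \<in> L1" "a \<in> A" "adj a x" by (auto simp: L1_def)
      \<comment> \<open>The hub \<open>x\<close> serves \<open>L1\<close> and the vertex
        \<open>a\<close> joined to it; then \<open>a\<close> becomes the hub for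
        \<open>A\<close>.\<close>
      have "gens (insert (?f x) (Y A) \<union> ?f ` (insert a L1)) N"
        by (rule star[OF start, of x x]) (use xa adjL1 in auto)
      then have "gens ((insert (?f x) (Y A) \<union> ?f ` (insert a L1)) \<union> ?f ` A) N"
        by (rule star[of _ _ a]) (use xa adjA in auto)
      then show ?thesis by (rule gens_mono) (use NM in auto)
    next
      case False
      have g: "gens (insert (?f x0) (Y A) \<union> ?f ` L1) N"
        by (rule star[OF start, of x0 x0]) (use x0 adjL1 in auto)
      show ?thesis
      proof (cases "A = {}")
        case True
        then show ?thesis by (intro gens_mono[OF g]) (use NM in auto)
      next
        case A: False
        then obtain a where a: "a \<in> A" by blast
        \<comment> \<open>No edge leads from \<open>L1\<close> to \<open>A\<close>, so the first
          triangle towards \<open>A\<close> is paid for; then \<open>a\<close> is the hub for the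
          rest.\<close>
        have "gens (insert (?f a) (insert (?f x0) (Y A) \<union> ?f ` L1) \<union> ?f ` A) (Suc N)"
          by (rule star[OF gens_insert_critical[OF g], where r = a]) (use a adjA in auto)
        moreover have "Suc N \<le> M"
          by (rule NM(2)) (use A False x0 in \<open>auto simp: L1_def\<close>)
        ultimately show ?thesis by (elim gens_mono) auto
      qed
    qed
  qed
  then show ?thesis using sub by (rule gens_mono) simp
qed

text \<open>The neighbours of \<open>v\<close> in \<open>c\<close> are added in the order
  \<open>P1\<close>, \<open>P2\<close>, \<open>P3\<close>. Within \<open>P1\<close> the point
  \<open>h\<close> joins \<open>Q\<close> to the earlier neighbours, and within \<open>P2\<close>
  the point \<open>h'\<close> does; a point of \<open>P3\<close> has no neighbour in
  \<open>Q\<close>. Only the start of \<open>P2\<close> can cost a generator.\<close>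

lemma gens_pair_vertex:
  assumes cd: "c \<noteq> d"
    and X: "mono_triangles \<subseteq> X" "\<And>t. t \<in> X \<Longrightarrow> \<not> {c, d} \<subseteq> cell ` t"
    and v: "v \<in> S" "cell v = d" "v \<notin> Q" and Q: "Q \<subseteq> {x \<in> S. cell x = d}"
    and h: "\<And>u. u \<in> S \<Longrightarrow> cell u = c \<Longrightarrow> adj u v \<Longrightarrow> \<exists>x\<in>Q. adj u x \<Longrightarrow>
      h \<in> Q \<and> adj u h \<or> h' \<in> Q \<and> adj u h'"
    and g: "gens (X \<union> pair_triangles c d Q) N"
  shows "gens (X \<union> pair_triangles c d (insert v Q)) (Suc N)"
proof -
  define Nv where "Nv = {x \<in> S. cell x = c \<and> adj x v}"
  define P1 where "P1 = {u \<in> Nv. h \<in> Q \<and> adj u h}"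
  define P2 where "P2 = {u \<in> Nv - P1. h' \<in> Q \<and> adj u h'}"
  define P3 where "P3 = Nv - P1 - P2"
  define Y where "Y = (\<lambda>A. X \<union> pair_triangles c d Q \<union> pair_star c d Q v A)"
  have "finite Nv" using finite_S by (simp add: Nv_def)
  then have fin: "finite P1" "finite P2" "finite P3" by (simp_all add: P1_def P2_def P3_def)
  have Nv_eq: "Nv = P1 \<union> P2 \<union> P3" by (auto simp: P1_def P2_def P3_def)
  have "c \<notin> cell ` t" if "t \<in> pair_star c d Q v {}" for t
    using that unfolding pair_star_def by blast
  moreover have "c \<in> cell ` t" if "t \<in> pair_star c d Q v {}" for t
    using that by (simp add: pair_star_def pair_triangles_def)
  ultimately have "pair_star c d Q v {} = {}" by blast
  then have Y0: "gens (Y {}) N" using g by (simp add: Y_def)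
  have step: "gens (Y (insert u A)) M"
    if "A \<subseteq> Nv" "u \<in> Nv" "u \<notin> A" "gens (Y A) N'" "N' \<le> M"
      "(\<exists>x\<in>Q. adj u x) \<Longrightarrow> A \<noteq> {} \<Longrightarrow> \<not> (\<exists>x\<in>Q. \<exists>a\<in>A. adj u x \<and> adj a x) \<Longrightarrow> Suc N' \<le> M"
    for A u N' M
    unfolding Y_def
  proof (rule gens_pair_star_insert[OF cd X v Q])
    show "A \<subseteq> {x \<in> S. cell x = c \<and> adj x v}" "u \<in> S" "cell u = c" "adj u v"
      using that(1,2) by (auto simp: Nv_def)
    show "gens (X \<union> pair_triangles c d Q \<union> pair_star c d Q v A) N'"
      using that(4) by (simp only: Y_def)
  qed (assumption | fact that)+
  have 1: "gens (Y A) N" if "A \<subseteq> P1" for A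
    using finite_subset[OF that fin(1)] that
  proof (induction A rule: finite_induct)
    case (insert u A)
    then have "gens (Y A) N" "u \<in> P1" "A \<subseteq> P1" by auto
    then show ?case
      using insert.hyps by (intro step[of A u N N]) (auto simp: P1_def)
  qed (rule Y0)
  \<comment> \<open>The first point of \<open>P2\<close> may share no neighbour in \<open>Q\<close>
    with \<open>P1\<close> and pays; each later one shares \<open>h'\<close> with the points of
    \<open>P2\<close> before it.\<close>
  have 2: "gens (Y (P1 \<union> A)) (if A = {} then N else Suc N)" if "A \<subseteq> P2" for A
    using finite_subset[OF that fin(2)] that
  proof (induction A rule: finite_induct)
    case empty
    then show ?case using 1 by simp
  next
    case (insert u A)
    then have "gens (Y (P1 \<union> A)) (if A = {} then N else Suc N)" "u \<in> P2" "A \<subseteq> P2" by auto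
    then have "gens (Y (insert u (P1 \<union> A))) (Suc N)"
      using insert.hyps
      by (intro step[of "P1 \<union> A" u "if A = {} then N else Suc N" "Suc N"])
        (auto simp: P1_def P2_def)
    then show ?case by simp
  qed
  have 3: "gens (Y (P1 \<union> P2 \<union> A)) (Suc N)" if "A \<subseteq> P3" for A
    using finite_subset[OF that fin(3)] that
  proof (induction A rule: finite_induct)
    case empty
    show ?case using 2[of P2] by (auto split: if_splits intro: gens_mono)
  next
    case (insert u A)
    then have a: "gens (Y (P1 \<union> P2 \<union> A)) (Suc N)" "u \<in> P3" "A \<subseteq> P3" by auto
    then have no: "\<not> (\<exists>x\<in>Q. adj u x)"
      using h[of u] by (auto simp: P1_def P2_def P3_def Nv_def)
    have "gens (Y (insert u (P1 \<union> P2 \<union> A))) (Suc N)"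
    proof (rule step[of "P1 \<union> P2 \<union> A" u "Suc N" "Suc N"])
      show "P1 \<union> P2 \<union> A \<subseteq> Nv" "u \<in> Nv" using a(2,3) unfolding Nv_eq by blast+
      show "u \<notin> P1 \<union> P2 \<union> A" using a(2) insert.hyps(2) unfolding P3_def by blast
    qed (use a(1) no in simp_all)
    then show ?case by simp
  qed
  from 3[OF order_refl] have "gens (Y Nv) (Suc N)" by (simp add: Nv_eq)
  moreover have "X \<union> pair_triangles c d (insert v Q) \<subseteq> Y Nv"
  proof -
    have "t \<in> Y Nv" if t: "t \<in> pair_triangles c d (insert v Q)" for t
    proof (cases "v \<in> t")
      case True
      then have "\<forall>x\<in>t. cell x = c \<longrightarrow> x \<in> Nv"
        using t by (auto simp: Nv_def pair_triangles_def triangles_iff)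
      then show ?thesis using t True by (auto simp: Y_def pair_star_def)
    next
      case False
      then show ?thesis using t by (auto simp: Y_def pair_triangles_def)
    qed
    then show ?thesis by (auto simp: Y_def)
  qed
  ultimately show ?thesis by (rule gens_mono) simp
qed

text \<open>\<open>elim\<close> provides an order of removal. Inserting in the reverse order costs
  at most one generator per point of \<open>d\<close>.\<close>

lemma gens_pair:
  assumes cd: "c \<noteq> d"
    and X: "mono_triangles \<subseteq> X" "\<And>t. t \<in> X \<Longrightarrow> \<not> {c, d} \<subseteq> cell ` t"
    and elim: "\<And>Q. Q \<subseteq> {x \<in> S. cell x = d} \<Longrightarrow> Q \<noteq> {} \<Longrightarrow>
      \<exists>v\<in>Q. \<exists>h h'. \<forall>u\<in>S. cell u = c \<longrightarrow> adj u v \<longrightarrow> (\<exists>x\<in>Q - {v}. adj u x) \<longrightarrow>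
        h \<in> Q - {v} \<and> adj u h \<or> h' \<in> Q - {v} \<and> adj u h'"
    and g: "gens X N"
  shows "gens (X \<union> {t \<in> triangles. cell ` t = {c, d}}) (N + card {x \<in> S. cell x = d})"
proof -
  have *: "gens (X \<union> pair_triangles c d Q) (N + card Q)" if "Q \<subseteq> {x \<in> S. cell x = d}" for Q
    using that
  proof (induction "card Q" arbitrary: Q)
    case 0
    have "finite Q" using 0 finite_S by (auto intro: finite_subset[of _ S])
    then have "Q = {}" using 0 by simp
    have "d \<notin> cell ` t" if "t \<in> pair_triangles c d Q" for t
      using that \<open>Q = {}\<close> unfolding pair_triangles_def by blast
    moreover have "d \<in> cell ` t" if "t \<in> pair_triangles c d Q" for t
      using that by (simp add: pair_triangles_def)
    ultimately have "pair_triangles c d Q = {}" by blast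
    then show ?case using g \<open>Q = {}\<close> by simp
  next
    case (Suc n)
    have fin: "finite Q" using Suc.prems finite_S by (auto intro: finite_subset[of _ S])
    have "Q \<noteq> {}" using Suc.hyps(2) by auto
    then obtain v h h' where v: "v \<in> Q" and h: "\<forall>u\<in>S. cell u = c \<longrightarrow> adj u v \<longrightarrow> (\<exists>x\<in>Q - {v}. adj u x) \<longrightarrow>
        h \<in> Q - {v} \<and> adj u h \<or> h' \<in> Q - {v} \<and> adj u h'"
      using elim[OF Suc.prems] by blast
    have "n = card (Q - {v})" using Suc.hyps(2) v fin by simp
    then have "gens (X \<union> pair_triangles c d (Q - {v})) (N + n)"
      using Suc.hyps(1)[of "Q - {v}"] Suc.prems by blast
    then have "gens (X \<union> pair_triangles c d (insert v (Q - {v}))) (Suc (N + n))"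
      by (intro gens_pair_vertex[OF cd X, of v "Q - {v}" h h']) (use h v Suc.prems in auto)
    then show ?case using v by (simp add: insert_absorb Suc.hyps(2)[symmetric])
  qed
  have "{t \<in> triangles. cell ` t = {c, d}} \<subseteq> pair_triangles c d {x \<in> S. cell x = d}"
    by (auto simp: pair_triangles_def triangles_iff)
  then show ?thesis using *[OF order_refl] by (elim gens_mono) auto
qed

section \<open>Triangles in three cells\<close>

definition typed_triangles :: "'c set \<Rightarrow> 'v set \<Rightarrow> 'v set set"
  where "typed_triangles T Q = {t \<in> triangles. cell ` t = T \<and> t \<subseteq> Q}"

definition move :: "'c set \<Rightarrow> 'v set \<Rightarrow> 'v set \<Rightarrow> 'v set \<Rightarrow> bool"
  where "move T Q t t' \<longleftrightarrow> t \<in> typed_triangles T Q \<and> t' \<in> typed_triangles T Q \<and>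
    (\<exists>x x' y z. t = {x, y, z} \<and> t' = {x', y, z} \<and> cell x = cell x')"

text \<open>If \<open>x\<close> and \<open>x'\<close> differ, they are adjacent and span a
  tetrahedron with \<open>y\<close> and \<open>z\<close>. Its other two faces contain both
  \<open>x\<close> and \<open>x'\<close>, so they meet at most two cells and are cleared.\<close>

lemma gens_move:
  assumes "gens X N" "{t \<in> triangles. card (cell ` t) \<le> 2} \<subseteq> X" "t \<in> X" "move T Q t t'"
  shows "gens (insert t' X) N"
proof -
  obtain x x' y z where t: "t = {x, y, z}" "t' = {x', y, z}" "cell x = cell x'"
    and tri: "t \<in> triangles" "t' \<in> triangles"
    using assms(4) by (auto simp: move_def typed_triangles_def)
  show ?thesis
  proof (cases "x' = x")
    case True
    then show ?thesis using assms(1,3) t by (simp add: insert_absorb)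
  next
    case False
    have d: "x \<noteq> y" "x \<noteq> z" "y \<noteq> z" "x' \<noteq> y" "x' \<noteq> z"
      using triangleD(1)[OF tri(1)] triangleD(1)[OF tri(2)] t by (auto simp: card_insert_if split: if_splits)
    have S: "x \<in> S" "x' \<in> S" "y \<in> S" "z \<in> S"
      using triangleD(2)[OF tri(1)] triangleD(2)[OF tri(2)] t by auto
    have a: "adj x y" "adj x z" "adj y z" "adj x' y" "adj x' z" "adj x x'"
      using triangleD(3)[OF tri(1)] triangleD(3)[OF tri(2)] t S by (auto intro: adj_cell)
    have low: "{x', w, x} \<in> X" if "{x', w, x} \<in> triangles" for w
    proof -
      have "cell ` {x', w, x} = {cell x, cell w}" using t(3) by auto
      then have "card (cell ` {x', w, x}) \<le> 2" by (simp add: card_insert_if)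
      then show ?thesis using that assms(2) by blast
    qed
    have "gens (insert {x', y, z} X) N"
    proof (rule gens_insert_face[OF assms(1), of x' y z x])
      show "{x', y, z, x} \<in> cliques" using S a adj_sym by (intro clique4I) auto
      show "{y, z, x} \<in> X" using assms(3) t(1) by (simp add: insert_commute)
      show "{x', z, x} \<in> X" "{x', y, x} \<in> X"
        using S a d False adj_sym by (auto intro!: low triangleI)
    qed (use d False in auto)
    then show ?thesis using t by simp
  qed
qed

text \<open>A maximal set of reachable triangles that can be added to \<open>X\<close> for free is
  closed under moves, by \<open>gens_move\<close>.\<close>

lemma gens_reachable:
  assumes "gens X N" "{t \<in> triangles. card (cell ` t) \<le> 2} \<subseteq> X" "t0 \<in> X"
  shows "gens (X \<union> {t. (move T Q)\<^sup>*\<^sup>* t0 t}) N"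
proof -
  let ?R = "{t. (move T Q)\<^sup>*\<^sup>* t0 t}"
  have "?R \<subseteq> insert t0 triangles"
  proof
    fix t assume "t \<in> ?R"
    then have "(move T Q)\<^sup>*\<^sup>* t0 t" by simp
    then show "t \<in> insert t0 triangles"
      by cases (auto simp: move_def typed_triangles_def)
  qed
  then have fin: "finite ?R" by (rule finite_subset) (simp add: finite_triangles)
  let ?C = "{Y \<in> Pow ?R. gens (X \<union> Y) N}"
  have "finite ?C" "{} \<in> ?C" using fin assms(1) by auto
  then obtain Y where Y: "Y \<in> ?C" "\<And>Y'. Y' \<in> ?C \<Longrightarrow> Y \<subseteq> Y' \<Longrightarrow> Y' = Y"
    using finite_has_maximal2[of ?C "{}"] by (metis (no_types, lifting))
  have "t \<in> X \<union> Y" if "(move T Q)\<^sup>*\<^sup>* t0 t" for t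
    using that
  proof (induction rule: rtranclp_induct)
    case base
    then show ?case using assms(3) by simp
  next
    case (step s t)
    have "gens (insert t (X \<union> Y)) N"
      by (rule gens_move[of "X \<union> Y" N s T Q t]) (use Y step assms(2) in auto)
    then have "insert t Y \<in> ?C" using Y(1) step.hyps by auto
    then have "insert t Y = Y" using Y(2) by blast
    then show ?case by blast
  qed
  then have "X \<union> ?R \<subseteq> X \<union> Y" by blast
  moreover have "gens (X \<union> Y) N" using Y(1) by simp
  ultimately show ?thesis using gens_mono by blast
qed

text \<open>Points are inserted against the order of removal given by \<open>conn\<close>. One
  triangle at the new point \<open>z\<close> is paid for, and moves lead from it to all others at
  \<open>z\<close>, possibly through triangles without \<open>z\<close>.\<close>

lemma gens_typed:
  assumes X: "{t \<in> triangles. card (cell ` t) \<le> 2} \<subseteq> X" and g: "gens X N"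
    and conn: "\<And>Q. Q \<subseteq> {x \<in> S. cell x \<in> T} \<Longrightarrow> Q \<noteq> {} \<Longrightarrow>
      \<exists>z\<in>Q. \<forall>t\<in>typed_triangles T Q. \<forall>t'\<in>typed_triangles T Q. z \<in> t \<longrightarrow> z \<in> t' \<longrightarrow>
        (move T Q)\<^sup>*\<^sup>* t t'"
  shows "gens (X \<union> {t \<in> triangles. cell ` t = T}) (N + card {x \<in> S. cell x \<in> T})"
proof -
  have *: "gens (X \<union> typed_triangles T Q) (N + card Q)" if "Q \<subseteq> {x \<in> S. cell x \<in> T}" for Q
    using that
  proof (induction "card Q" arbitrary: Q)
    case 0
    have "finite Q" using 0 finite_S by (auto intro: finite_subset[of _ S])
    then have Q: "Q = {}" using 0 by simp
    then have "typed_triangles T Q = {}" by (auto simp: typed_triangles_def triangles_def)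
    then show ?case using g Q by simp
  next
    case (Suc n)
    have fin: "finite Q" using Suc.prems finite_S by (auto intro: finite_subset[of _ S])
    have "Q \<noteq> {}" using Suc.hyps(2) by auto
    then obtain z where z: "z \<in> Q" and c: "\<forall>t\<in>typed_triangles T Q. \<forall>t'\<in>typed_triangles T Q. z \<in> t \<longrightarrow> z \<in> t' \<longrightarrow>
        (move T Q)\<^sup>*\<^sup>* t t'"
      using conn[OF Suc.prems] by blast
    have "n = card (Q - {z})" using Suc.hyps(2) z fin by simp
    then have IH: "gens (X \<union> typed_triangles T (Q - {z})) (N + n)"
      using Suc.hyps(1)[of "Q - {z}"] Suc.prems by blast
    show ?case
    proof (cases "\<exists>t0\<in>typed_triangles T Q. z \<in> t0")
      case True
      then obtain t0 where t0: "t0 \<in> typed_triangles T Q" "z \<in> t0" by blast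
      let ?X = "insert t0 (X \<union> typed_triangles T (Q - {z}))"
      have "gens (?X \<union> {t. (move T Q)\<^sup>*\<^sup>* t0 t}) (Suc (N + n))"
        by (rule gens_reachable[OF gens_insert_critical[OF IH]]) (use X in auto)
      moreover have "X \<union> typed_triangles T Q \<subseteq> ?X \<union> {t. (move T Q)\<^sup>*\<^sup>* t0 t}"
      proof -
        have "t \<in> typed_triangles T (Q - {z}) \<or> (move T Q)\<^sup>*\<^sup>* t0 t" if "t \<in> typed_triangles T Q" for t
          using that c t0 by (cases "z \<in> t") (auto simp: typed_triangles_def)
        then show ?thesis by blast
      qed
      ultimately show ?thesis by (rule gens_mono) (use Suc.hyps(2) in simp)
    next
      case False
      then have "typed_triangles T Q \<subseteq> typed_triangles T (Q - {z})"
        by (auto simp: typed_triangles_def)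
      then show ?thesis using IH by (elim gens_mono) (use Suc.hyps(2) in auto)
    qed
  qed
  have "{t \<in> triangles. cell ` t = T} \<subseteq> typed_triangles T {x \<in> S. cell x \<in> T}"
    by (auto simp: typed_triangles_def triangles_iff)
  then show ?thesis using *[OF order_refl] by (elim gens_mono) auto
qed

text \<open>Triangles are cleared by increasing number of cells. Pairs come before triples because
  \<open>gens_pair\<close> needs the edges between its two cells to be new, and
  \<open>gens_move\<close> needs all triangles in at most two cells.\<close>

theorem reduced_betti_le_sum:
  assumes elim: "\<And>c d Q. c \<noteq> d \<Longrightarrow> Q \<subseteq> {x \<in> S. cell x = d} \<Longrightarrow> Q \<noteq> {} \<Longrightarrow>
      \<exists>v\<in>Q. \<exists>h h'. \<forall>u\<in>S. cell u = c \<longrightarrow> adj u v \<longrightarrow> (\<exists>x\<in>Q - {v}. adj u x) \<longrightarrow>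
        h \<in> Q - {v} \<and> adj u h \<or> h' \<in> Q - {v} \<and> adj u h'"
    and conn: "\<And>T Q. card T = 3 \<Longrightarrow> Q \<subseteq> {x \<in> S. cell x \<in> T} \<Longrightarrow> Q \<noteq> {} \<Longrightarrow>
      \<exists>z\<in>Q. \<forall>t\<in>typed_triangles T Q. \<forall>t'\<in>typed_triangles T Q. z \<in> t \<longrightarrow> z \<in> t' \<longrightarrow>
        (move T Q)\<^sup>*\<^sup>* t t'"
  shows "reduced_betti F cliques 2 \<le> (\<Sum>T\<in>(`) cell ` triangles. card {x \<in> S. cell x \<in> T})"
proof -
  let ?m = "\<lambda>T. card {x \<in> S. cell x \<in> T}"
  define T2 where "T2 = {T \<in> (`) cell ` triangles. card T = 2}"
  define T3 where "T3 = {T \<in> (`) cell ` triangles. card T = 3}"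
  have fin: "finite T2" "finite T3" using finite_triangles by (auto simp: T2_def T3_def)
  have types: "card (cell ` t) = 1 \<or> card (cell ` t) = 2 \<or> card (cell ` t) = 3" if "t \<in> triangles" for t
  proof -
    have "finite t" "t \<noteq> {}" using triangleD(1)[OF that] card.infinite by fastforce+
    then have "card (cell ` t) \<le> 3" "card (cell ` t) \<noteq> 0"
      using card_image_le[of t cell] triangleD(1)[OF that] by auto
    then show ?thesis by linarith
  qed
  have 2: "gens (mono_triangles \<union> {t \<in> triangles. cell ` t \<in> \<A>}) (sum ?m \<A>)" if "\<A> \<subseteq> T2" for \<A>
    using finite_subset[OF that fin(1)] that
  proof (induction \<A> rule: finite_induct)
    case empty
    then show ?case using gens_mono_triangles by simp
  next
    case (insert P \<A>)
    let ?X = "mono_triangles \<union> {t \<in> triangles. cell ` t \<in> \<A>}"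
    have IH: "gens ?X (sum ?m \<A>)" using insert by blast
    have "card P = 2" using insert.prems by (auto simp: T2_def)
    then obtain c d where cd: "P = {c, d}" "c \<noteq> d" by (auto simp: card_2_iff)
    \<comment> \<open>Neither a single cell nor another pair contains the pair
      \<open>{c, d}\<close>.\<close>
    have "\<not> {c, d} \<subseteq> cell ` t" if "t \<in> ?X" for t
    proof
      assume sub: "{c, d} \<subseteq> cell ` t"
      show False
      proof (cases "t \<in> mono_triangles")
        case True
        then obtain e where "cell ` t = {e}" by (auto simp: mono_triangles_def)
        then show ?thesis using sub cd(2) by simp
      next
        case False
        then have "cell ` t \<in> \<A>" using that by blast
        moreover from this have "card (cell ` t) = 2" using insert.prems by (auto simp: T2_def)
        then have "{c, d} = cell ` t"
          using sub cd(2) by (intro card_subset_eq) (auto intro: card_ge_0_finite)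
        ultimately show ?thesis using insert.hyps(2) cd(1) by simp
      qed
    qed
    then have "gens (?X \<union> {t \<in> triangles. cell ` t = {c, d}}) (sum ?m \<A> + card {x \<in> S. cell x = d})"
      by (intro gens_pair[OF cd(2) _ _ elim[OF cd(2)] IH]) auto
    moreover have "card {x \<in> S. cell x = d} \<le> ?m P"
      using finite_S cd(1) by (intro card_mono) auto
    ultimately show ?case
      using insert.hyps by (elim gens_mono) (auto simp: cd(1))
  qed
  let ?X2 = "{t \<in> triangles. card (cell ` t) \<le> 2}"
  have "?X2 \<subseteq> mono_triangles \<union> {t \<in> triangles. cell ` t \<in> T2}"
  proof
    fix t assume t: "t \<in> ?X2"
    then have "card (cell ` t) = 1 \<or> card (cell ` t) = 2" using types by fastforce
    then show "t \<in> mono_triangles \<union> {t \<in> triangles. cell ` t \<in> T2}"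
      using t by (auto simp: mono_triangles_def T2_def card_1_singleton_iff)
  qed
  then have X2: "gens ?X2 (sum ?m T2)" using 2[OF order_refl] by (elim gens_mono) auto
  have 3: "gens (?X2 \<union> {t \<in> triangles. cell ` t \<in> \<A>}) (sum ?m T2 + sum ?m \<A>)" if "\<A> \<subseteq> T3" for \<A>
    using finite_subset[OF that fin(2)] that
  proof (induction \<A> rule: finite_induct)
    case empty
    then show ?case using X2 by simp
  next
    case (insert T \<A>)
    let ?X = "?X2 \<union> {t \<in> triangles. cell ` t \<in> \<A>}"
    have IH: "gens ?X (sum ?m T2 + sum ?m \<A>)" using insert by blast
    have "card T = 3" using insert.prems by (auto simp: T3_def)
    then have "gens (?X \<union> {t \<in> triangles. cell ` t = T}) (sum ?m T2 + sum ?m \<A> + ?m T)"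
      by (intro gens_typed[OF _ IH conn]) auto
    then show ?case
      using insert.hyps by (elim gens_mono) auto
  qed
  have "reduced_betti F cliques 2 \<le> sum ?m T2 + sum ?m T3"
    using types by (intro reduced_betti_le_if_gens[OF 3[OF order_refl]]) (fastforce simp: T3_def)
  also have "\<dots> = sum ?m (T2 \<union> T3)"
    using fin by (intro sum.union_disjoint[symmetric]) (auto simp: T2_def T3_def)
  also have "\<dots> \<le> sum ?m ((`) cell ` triangles)"
    using finite_triangles by (intro sum_mono2) (auto simp: T2_def T3_def)
  finally show ?thesis .
qed

end

section \<open>Connectedness of triangles and plane geometry\<close>

context cell_complex
begin

section \<open>Moves between triangles with a common vertex\<close>

lemma typed_triangleD:
  assumes "t \<in> typed_triangles T Q"
  shows "t \<in> triangles" "cell ` t = T" "t \<subseteq> Q"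
  using assms by (auto simp: typed_triangles_def)

lemma typed_inj:
  assumes "t \<in> typed_triangles T Q" "card T = 3"
  shows "inj_on cell t"
proof (rule eq_card_imp_inj_on)
  show "finite t"
    using triangleD(1)[OF typed_triangleD(1)[OF assms(1)]] card.infinite by fastforce
  show "card (cell ` t) = card t"
    using triangleD(1)[OF typed_triangleD(1)[OF assms(1)]] typed_triangleD(2)[OF assms(1)] assms(2)
    by simp
qed

text \<open>On triangles with three cells \<open>cell\<close> is injective, so the vertices of two
  of them correspond, and a common vertex corresponds to itself.\<close>

lemma typed_match:
  assumes T: "card T = 3" and t: "t \<in> typed_triangles T Q" "t' \<in> typed_triangles T Q"
    and x: "x \<in> t" "x \<in> t'" and y: "y \<in> t" "y \<noteq> x"
  obtains z y' z' where "t = {x, y, z}" "t' = {x, y', z'}" "distinct [x, y, z]" "distinct [x, y', z']"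
    "cell y = cell y'" "cell z = cell z'" "cell x \<noteq> cell y" "cell x \<noteq> cell z" "cell y \<noteq> cell z"
proof -
  note inj = typed_inj[OF t(1) T] typed_inj[OF t(2) T]
  obtain z where z: "t = {x, y, z}" "x \<noteq> z" "y \<noteq> z"
    using card_3_with2[OF triangleD(1)[OF typed_triangleD(1)[OF t(1)]] x(1) y(1)] y(2) by metis
  have c: "cell x \<noteq> cell y" "cell x \<noteq> cell z" "cell y \<noteq> cell z"
    using inj(1) z y(2) by (auto simp: inj_on_def)
  have "cell y \<in> cell ` t'"
    using y(1) typed_triangleD(2)[OF t(1)] typed_triangleD(2)[OF t(2)] by (metis imageI)
  then obtain y' where y': "y' \<in> t'" "cell y = cell y'" by auto
  then have "y' \<noteq> x" using c by auto
  then obtain z' where z': "t' = {x, y', z'}" "x \<noteq> z'" "y' \<noteq> z'"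
    using card_3_with2[OF triangleD(1)[OF typed_triangleD(1)[OF t(2)]] x(2) y'(1)] by metis
  have "cell z \<in> cell ` t'"
    using z(1) typed_triangleD(2)[OF t(1)] typed_triangleD(2)[OF t(2)] by (metis imageI insertCI)
  then have "cell z = cell x \<or> cell z = cell y' \<or> cell z = cell z'"
    using z'(1) by auto
  then have zz: "cell z = cell z'"
    using c y'(2) by metis
  show ?thesis
    by (rule that[OF z(1) z'(1) _ _ y'(2) zz c]) (use z z' y(2) \<open>y' \<noteq> x\<close> in auto)
qed

lemma move_sym: "move T Q t t' \<Longrightarrow> move T Q t' t"
  unfolding move_def by metis

lemma moves_sym: "(move T Q)\<^sup>*\<^sup>* t t' \<Longrightarrow> (move T Q)\<^sup>*\<^sup>* t' t"
  using symp_rtranclp[of "move T Q"] move_sym by (metis sympE sympI)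

text \<open>The crossed edge \<open>yz'\<close> yields the triangle \<open>{x, y, z'}\<close>
  halfway between the two.\<close>

lemma moves_if_adj:
  assumes t: "{x, y, z} \<in> typed_triangles T Q" "{x, y', z'} \<in> typed_triangles T Q"
    and c: "cell y = cell y'" "cell z = cell z'" and d: "x \<noteq> y" "x \<noteq> z'" "y \<noteq> z'" and a: "adj y z'"
  shows "(move T Q)\<^sup>*\<^sup>* {x, y, z} {x, y', z'}"
proof -
  note D = typed_triangleD[OF t(1)] typed_triangleD[OF t(2)]
  have S: "x \<in> S" "y \<in> S" "z' \<in> S" "x \<in> Q" "y \<in> Q" "z' \<in> Q"
    using triangleD(2)[OF D(1)] triangleD(2)[OF D(4)] D(3,6) by auto
  have "{x, y, z'} \<in> triangles"
    using S d a triangleD(3)[OF D(1)] triangleD(3)[OF D(4)] by (intro triangleI) auto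
  moreover have "cell ` {x, y, z'} = T" using D(2) c by auto
  ultimately have m: "{x, y, z'} \<in> typed_triangles T Q"
    using S by (simp add: typed_triangles_def)
  have "{x, y, z} = {z, x, y}" "{x, y, z'} = {z', x, y}"
    "{x, y, z'} = {y, x, z'}" "{x, y', z'} = {y', x, z'}" by auto
  then have "move T Q {x, y, z} {x, y, z'}" "move T Q {x, y, z'} {x, y', z'}"
    using t m c unfolding move_def by metis+
  then show ?thesis using rtranclp_trans[OF r_into_rtranclp r_into_rtranclp] by metis
qed

lemma moves_if_adj':
  assumes t: "{x, y, z} \<in> typed_triangles T Q" "{x, y', z'} \<in> typed_triangles T Q"
    and c: "cell y = cell y'" "cell z = cell z'" and d: "x \<noteq> y'" "x \<noteq> z" "y' \<noteq> z" and a: "adj y' z"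
  shows "(move T Q)\<^sup>*\<^sup>* {x, y, z} {x, y', z'}"
  using moves_if_adj[OF t(2,1) c[symmetric] d a] moves_sym by blast

text \<open>Any point of cell \<open>c\<close> in \<open>Q\<close> will do, since the crossed edge
  is always there. If \<open>Q\<close> misses \<open>c\<close>, there are no triangles at
  all.\<close>

lemma conn_if_complete:
  assumes T: "card T = 3" and Q: "Q \<subseteq> {x \<in> S. cell x \<in> T}" "Q \<noteq> {}" and c: "c \<in> T"
    and complete: "\<And>x y. x \<in> Q \<Longrightarrow> y \<in> Q \<Longrightarrow> cell x \<noteq> c \<Longrightarrow> cell y \<noteq> c \<Longrightarrow> cell x \<noteq> cell y \<Longrightarrow> adj x y"
  shows "\<exists>z\<in>Q. \<forall>t\<in>typed_triangles T Q. \<forall>t'\<in>typed_triangles T Q. z \<in> t \<longrightarrow> z \<in> t' \<longrightarrow>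
    (move T Q)\<^sup>*\<^sup>* t t'"
proof (cases "\<exists>z\<in>Q. cell z = c")
  case True
  then obtain z where z: "z \<in> Q" "cell z = c" by blast
  have "(move T Q)\<^sup>*\<^sup>* t t'"
    if t: "t \<in> typed_triangles T Q" "t' \<in> typed_triangles T Q" "z \<in> t" "z \<in> t'" for t t'
  proof -
    obtain y where "y \<in> t" "y \<noteq> z"
      using card_3_with[OF triangleD(1)[OF typed_triangleD(1)[OF t(1)]] t(3)] by (metis insertCI)
    then obtain w y' w' where m: "t = {z, y, w}" "t' = {z, y', w'}" "distinct [z, y, w]" "distinct [z, y', w']"
      "cell y = cell y'" "cell w = cell w'" "cell z \<noteq> cell y" "cell z \<noteq> cell w" "cell y \<noteq> cell w"
      using typed_match[OF T t(1,2,3,4)] by metis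
    have "y \<in> Q" "w' \<in> Q" using m typed_triangleD(3)[OF t(1)] typed_triangleD(3)[OF t(2)] by auto
    then have "adj y w'" using complete m z by auto
    moreover have "y \<noteq> w'" using m by auto
    ultimately show ?thesis
      using moves_if_adj[of z y w T Q y' w'] t m by simp
  qed
  then show ?thesis using z(1) by blast
next
  case False
  have "typed_triangles T Q = {}"
  proof (rule ccontr)
    assume "typed_triangles T Q \<noteq> {}"
    then obtain t where t: "t \<in> typed_triangles T Q" by blast
    then have "c \<in> cell ` t" using c typed_triangleD(2) by blast
    then show False using False typed_triangleD(3)[OF t] by auto
  qed
  then show ?thesis using Q(2) by blast
qed

end

section \<open>Two cells: which point to remove\<close>

lemma eliminable_if_between:
  fixes key :: "'v \<Rightarrow> real"
  assumes Q: "finite Q" "Q \<noteq> {}"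
    and btw: "\<And>u u' a b e. u \<in> U \<Longrightarrow> u' \<in> U \<Longrightarrow> a \<in> Q \<Longrightarrow> b \<in> Q \<Longrightarrow> e \<in> Q \<Longrightarrow>
      key a \<le> key b \<Longrightarrow> key b \<le> key e \<Longrightarrow> adj u a \<Longrightarrow> adj u e \<Longrightarrow> \<not> adj u b \<Longrightarrow> adj u' b \<Longrightarrow>
      adj u' a \<or> adj u' e"
  shows "\<exists>v\<in>Q. \<exists>h h'. \<forall>u\<in>U. adj u v \<longrightarrow> (\<exists>x\<in>Q - {v}. adj u x) \<longrightarrow>
    h \<in> Q - {v} \<and> adj u h \<or> h' \<in> Q - {v} \<and> adj u h'"
proof (cases "\<exists>u\<in>U. \<exists>a\<in>Q. \<exists>b\<in>Q. \<exists>e\<in>Q. key a \<le> key b \<and> key b \<le> key e \<and> adj u a \<and> adj u e \<and> \<not> adj u b")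
  case True
  then obtain u a b e where *: "u \<in> U" "a \<in> Q" "b \<in> Q" "e \<in> Q" "key a \<le> key b" "key b \<le> key e"
    "adj u a" "adj u e" "\<not> adj u b" by blast
  \<comment> \<open>The point to remove is \<open>b\<close>, with \<open>h = a\<close> and
    \<open>h' = e\<close>.\<close>
  then have "a \<in> Q - {b}" "e \<in> Q - {b}" by auto
  then show ?thesis
    using *(3) btw[OF *(1) _ *(2,3,4,5,6,7,8,9)] by blast
next
  case False
  have min: "\<exists>m\<in>A. \<forall>x\<in>A. key m \<le> key x" if "finite A" "A \<noteq> {}" for A
    using ex_min_if_finite[of "key ` A"] that by (auto simp: not_less)
  obtain v where v: "v \<in> Q" "\<forall>x\<in>Q. key v \<le> key x" using min[OF Q] by blast
  show ?thesis
  proof (cases "Q - {v} = {}")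
    case True
    then show ?thesis using v(1) by blast
  next
    case ne: False
    obtain h where h: "h \<in> Q - {v}" "\<forall>x\<in>Q - {v}. key h \<le> key x" using min[OF _ ne] Q(1) by auto
    \<comment> \<open>The second point \<open>h\<close> lies between the first point
      \<open>v\<close> and \<open>x\<close>, and no neighbourhood has a gap.\<close>
    have "adj u h" if "u \<in> U" "adj u v" "\<exists>x\<in>Q - {v}. adj u x" for u
      using that False v h by (metis DiffD1)
    then show ?thesis using v(1) h(1) by blast
  qed
qed

text \<open>The first coordinate points from the centres \<open>u\<close>, \<open>t\<close> to the
  points \<open>p\<close>, \<open>q\<close>. Write \<open>(a, b)\<close> for \<open>t - u\<close>
  and \<open>(x, y)\<close> for \<open>q - p\<close>. If the claim failed, the distances would force
  these two displacements to have negative inner product although \<open>b\<close> and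
  \<open>y\<close> are nonnegative; the direction of \<open>t - u\<close> then decides which
  distance bound breaks.\<close>

lemma between_core:
  fixes ux uy tx ty px py qx qy :: real
  assumes up: "(px - ux)\<^sup>2 + (py - uy)\<^sup>2 > 1" and uq: "(qx - ux)\<^sup>2 + (qy - uy)\<^sup>2 \<le> 1"
    and tp: "(px - tx)\<^sup>2 + (py - ty)\<^sup>2 \<le> 1"
    and pq: "py \<le> qy" and ut: "uy \<le> ty"
    and A: "px - ux \<ge> 9/10" "px - tx \<ge> 9/10" "qx - ux \<ge> 9/10"
    and B: "\<bar>py - uy\<bar> \<le> 1/10" "\<bar>py - ty\<bar> \<le> 1/10" "\<bar>qy - uy\<bar> \<le> 1/10"
    and small: "\<bar>tx - ux\<bar> \<le> 1/50" "\<bar>qx - px\<bar> \<le> 1/50"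
  shows "(qx - tx)\<^sup>2 + (qy - ty)\<^sup>2 \<le> 1"
proof (rule ccontr)
  assume "\<not> ?thesis"
  then have tq: "(qx - tx)\<^sup>2 + (qy - ty)\<^sup>2 > 1" by simp
  define a b x y where "a = tx - ux" "b = ty - uy" "x = qx - px" "y = qy - py"
  note defs = a_b_x_y_def
  have b0: "b \<ge> 0" and y0: "y \<ge> 0" using ut pq by (auto simp: defs)
  have 1: "2 * ((qx - ux) * a + (qy - uy) * b) < a\<^sup>2 + b\<^sup>2"
    using uq tq by (simp add: defs power2_eq_square algebra_simps)
  have 2: "2 * ((px - ux) * a + (py - uy) * b) > a\<^sup>2 + b\<^sup>2"
    using up tp by (simp add: defs power2_eq_square algebra_simps)
  have 3: "x * a + y * b < 0"
    using 1 2 by (simp add: defs power2_eq_square algebra_simps)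
  consider "a \<ge> b" | "0 < a" "a < b" | "a \<le> 0" "a < b" by linarith
  then show False
  proof cases
    \<comment> \<open>Here \<open>t\<close> is no farther from \<open>q\<close> than
      \<open>u\<close> is.\<close>
    case 1
    then have a0: "a \<ge> 0" using b0 by simp
    have "(qx - ux) * a \<ge> 9/10 * a" using A(3) a0 by (intro mult_right_mono) auto
    moreover have "(qy - uy) * b \<ge> - (1/10) * b" by (rule mult_right_mono) (use B(3) b0 in linarith)+
    moreover have "a\<^sup>2 \<le> 1/50 * a" using small(1) a0
      unfolding power2_eq_square by (intro mult_right_mono) (auto simp: defs)
    moreover have "b\<^sup>2 \<le> a\<^sup>2" using 1 b0 by (intro power_mono) auto
    ultimately have "9/5 * a - 1/5 * b < 1/25 * a"
      using \<open>2 * ((qx - ux) * a + (qy - uy) * b) < a\<^sup>2 + b\<^sup>2\<close> by simp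
    then show False using 1 a0 by linarith
  next
    \<comment> \<open>Here \<open>q - p\<close> points back towards the centres, so \<open>q\<close>
      is nearer to \<open>t\<close> than \<open>p\<close> is.\<close>
    case 2
    have "y * a \<le> y * b" using 2 y0 by (intro mult_left_mono) auto
    then have "(x + y) * a < 0" using 3 by (simp add: algebra_simps)
    then have xy: "x + y < 0" using 2 by (simp add: mult_less_0_iff)
    define k l r where "k = (px - tx) * x" and "l = (py - ty) * y"
      and "r = (px - tx)\<^sup>2 + (py - ty)\<^sup>2"
    have "k \<le> 9/10 * x" unfolding k_def using A(2) xy y0 by (intro mult_right_mono_neg) auto
    moreover have "l \<le> 1/10 * y"
      unfolding l_def by (rule mult_right_mono) (use B(2) y0 in linarith)+
    moreover have "x\<^sup>2 + y\<^sup>2 \<le> - x / 25"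
    proof -
      have "(- x) * (- x) \<le> 1/50 * (- x)"
        using small(2) xy y0 by (intro mult_right_mono) (auto simp: defs)
      moreover have "y * y \<le> (- x) * (- x)" using xy y0 by (intro mult_mono) auto
      ultimately have "x * x + y * y \<le> - x / 25" by simp
      then show ?thesis by (simp add: power2_eq_square)
    qed
    moreover have "(qx - tx)\<^sup>2 + (qy - ty)\<^sup>2 = r + 2 * (k + l) + (x\<^sup>2 + y\<^sup>2)"
      by (simp add: defs k_def l_def r_def power2_eq_square algebra_simps)
    then have "1 < r + 2 * (k + l) + (x\<^sup>2 + y\<^sup>2)" using tq by simp
    moreover have "r \<le> 1" using tp by (simp add: r_def)
    ultimately have "0 < 9/5 * x + 1/5 * y - 1/25 * x" by simp
    then show False using xy y0 by linarith
  next
    \<comment> \<open>The bounds for \<open>p\<close> make \<open>t - u\<close> almost vertical. So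
      \<open>q - p\<close> is almost horizontal and points away from the centres, and
      \<open>q\<close> is farther from \<open>u\<close> than \<open>p\<close> is.\<close>
    case 3
    define k l where "k = (px - ux) * a" and "l = (py - uy) * b"
    have "k \<le> 9/10 * a" unfolding k_def using A(1) 3 by (intro mult_right_mono_neg) auto
    moreover have "l \<le> 1/10 * b"
      unfolding l_def by (rule mult_right_mono) (use B(1) b0 in linarith)+
    moreover have "0 < 2 * (k + l)"
      unfolding k_def l_def by (rule order.strict_trans1[OF _ 2]) simp
    ultimately have ab: "- 9 * a < b" by simp
    then have bpos: "b > 0" using 3 by linarith
    have "0 \<le> y * b" using y0 b0 by simp
    then have "x * a < 0" using \<open>x * a + y * b < 0\<close> by linarith
    then have x0: "x > 0" using 3 by (simp add: mult_less_0_iff)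
    have "x * (- 9 * a) \<le> x * b" using ab x0 by (intro mult_left_mono) auto
    then have "9 * y * b < x * b" using \<open>x * a + y * b < 0\<close> by (simp add: algebra_simps)
    then have yx: "9 * y < x" using bpos by simp
    define m n r where "m = (px - ux) * x" and "n = (py - uy) * y"
      and "r = (px - ux)\<^sup>2 + (py - uy)\<^sup>2"
    have "m \<ge> 9/10 * x" unfolding m_def using A(1) x0 by (intro mult_right_mono) auto
    moreover have "n \<ge> - (1/10) * y"
      unfolding n_def by (rule mult_right_mono) (use B(1) y0 in linarith)+
    moreover have "(qx - ux)\<^sup>2 + (qy - uy)\<^sup>2 = r + 2 * (m + n) + (x\<^sup>2 + y\<^sup>2)"
      by (simp add: defs m_def n_def r_def power2_eq_square algebra_simps)
    then have "r + 2 * (m + n) + (x\<^sup>2 + y\<^sup>2) \<le> 1" using uq by simp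
    then have "r + 2 * (m + n) \<le> 1" by (rule order.trans[rotated]) simp
    then have "r + 2 * m + 2 * n \<le> 1" by simp
    moreover have "r > 1" using up by (simp add: r_def)
    ultimately show False using x0 yx y0 by linarith
  qed
qed

section \<open>Three cells: estimates for nearly equilateral triangles\<close>

lemma norm_sq_perturb:
  fixes a a0 b b0 b' :: "'a::real_inner"
  assumes "norm (a - a0) \<le> 1/100" "norm (b - b0) \<le> 1/100" "norm (b' - b) \<le> 1/100"
  shows "\<bar>(norm (b' - a))\<^sup>2 - (norm (b - a))\<^sup>2 - 2 * ((b' - b) \<bullet> (b0 - a0))\<bar> \<le> norm (b' - b) / 20"
proof -
  let ?n = "norm (b' - b)"
  \<comment> \<open>First order expansion with the direction taken at the reference points
    \<open>a0\<close>, \<open>b0\<close>. The direction contributes an error of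
    \<open>2 * ?n / 50\<close>, the square term one of \<open>?n / 100\<close>.\<close>
  have "(norm (b' - a))\<^sup>2 - (norm (b - a))\<^sup>2 - 2 * ((b' - b) \<bullet> (b0 - a0)) =
    2 * ((b' - b) \<bullet> ((b - b0) - (a - a0))) + ?n\<^sup>2"
    by (simp add: power2_norm_eq_inner inner_diff_left inner_diff_right inner_commute algebra_simps)
  moreover have "\<bar>(b' - b) \<bullet> ((b - b0) - (a - a0))\<bar> \<le> ?n * norm ((b - b0) - (a - a0))"
    by (rule Cauchy_Schwarz_ineq2)
  moreover have "norm ((b - b0) - (a - a0)) \<le> 1/50"
    using norm_triangle_ineq4[of "b - b0" "a - a0"] assms by simp
  then have "?n * norm ((b - b0) - (a - a0)) \<le> ?n * (1/50)"
    by (intro mult_left_mono) auto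
  moreover have "?n\<^sup>2 \<le> 1/100 * ?n"
    unfolding power2_eq_square using assms(3) by (intro mult_right_mono) auto
  moreover have "0 \<le> ?n\<^sup>2" by simp
  ultimately show ?thesis by linarith
qed

text \<open>Three vectors in the plane are linearly dependent, so their Gram determinant vanishes;
  this is its expansion.\<close>

lemma gram_plane:
  fixes d p q :: "real^2"
  shows "(d \<bullet> d) * ((p \<bullet> p) * (q \<bullet> q) - (p \<bullet> q)\<^sup>2) =
    (d \<bullet> p)\<^sup>2 * (q \<bullet> q) + (d \<bullet> q)\<^sup>2 * (p \<bullet> p) - 2 * (d \<bullet> p) * (d \<bullet> q) * (p \<bullet> q)"
  by (simp add: inner_vec_def sum_2 power2_eq_square algebra_simps)

text \<open>\<open>p\<close> and \<open>q\<close> are nearly unit vectors at an angle of about 60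
  degrees. If both inner products with \<open>d\<close> were small, the Gram identity would bound
  \<open>0.6 * n^2\<close> by less than \<open>0.28 * n^2\<close>.\<close>

lemma near_perpendicular:
  fixes d p q :: "real^2"
  assumes p: "98/100 \<le> norm p" "norm p \<le> 1" and q: "98/100 \<le> norm q" "norm q \<le> 1"
    and pq: "98/100 \<le> norm (p - q)" "norm (p - q) \<le> 1"
    and d: "\<bar>d \<bullet> p\<bar> \<le> norm d / 40"
  shows "norm d / 2 \<le> \<bar>d \<bullet> q\<bar>"
proof (rule ccontr)
  assume "\<not> ?thesis"
  then have dq: "\<bar>d \<bullet> q\<bar> < norm d / 2" by simp
  define n where "n = norm d"
  have n: "n > 0" using dq by (auto simp: n_def)
  have sq: "96/100 \<le> (norm x)\<^sup>2 \<and> (norm x)\<^sup>2 \<le> 1" if "98/100 \<le> norm x" "norm x \<le> 1" for x :: "real^2"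
    using power_mono[OF that(1), of 2] power_mono[OF that(2), of 2] by (simp add: power2_eq_square)
  have P: "96/100 \<le> p \<bullet> p" "p \<bullet> p \<le> 1" and Q: "96/100 \<le> q \<bullet> q" "q \<bullet> q \<le> 1"
    and R: "96/100 \<le> (p - q) \<bullet> (p - q)" "(p - q) \<bullet> (p - q) \<le> 1"
    using sq[OF p] sq[OF q] sq[OF pq] by (auto simp: power2_norm_eq_inner)
  have "(p - q) \<bullet> (p - q) = p \<bullet> p + q \<bullet> q - 2 * (p \<bullet> q)"
    by (simp add: inner_diff_left inner_diff_right inner_commute)
  then have r: "46/100 \<le> p \<bullet> q" "p \<bullet> q \<le> 52/100" using P Q R by linarith+
  have "(p \<bullet> p) * (q \<bullet> q) \<ge> 96/100 * (96/100)" using P Q by (intro mult_mono) auto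
  moreover have "(p \<bullet> q)\<^sup>2 \<le> (52/100)\<^sup>2" using r by (intro power_mono) auto
  ultimately have det: "(p \<bullet> p) * (q \<bullet> q) - (p \<bullet> q)\<^sup>2 \<ge> 6/10" by (simp add: power2_eq_square)
  have "n\<^sup>2 * (6/10) \<le> n\<^sup>2 * ((p \<bullet> p) * (q \<bullet> q) - (p \<bullet> q)\<^sup>2)"
    using det by (intro mult_left_mono) auto
  also have "\<dots> = (d \<bullet> p)\<^sup>2 * (q \<bullet> q) + (d \<bullet> q)\<^sup>2 * (p \<bullet> p) - 2 * (d \<bullet> p) * (d \<bullet> q) * (p \<bullet> q)"
    unfolding n_def power2_norm_eq_inner by (rule gram_plane)
  also have "\<dots> \<le> (n/40)\<^sup>2 + (n/2)\<^sup>2 + n/40 * (n/2) * 2"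
  proof -
    have "(d \<bullet> p)\<^sup>2 \<le> (n/40)\<^sup>2" using d by (intro power2_le_iff_abs_le[THEN iffD2]) (auto simp: n_def)
    then have "(d \<bullet> p)\<^sup>2 * (q \<bullet> q) \<le> (n/40)\<^sup>2 * 1" using Q by (intro mult_mono) auto
    moreover have "(d \<bullet> q)\<^sup>2 \<le> (n/2)\<^sup>2" using dq by (intro power2_le_iff_abs_le[THEN iffD2]) (auto simp: n_def)
    then have "(d \<bullet> q)\<^sup>2 * (p \<bullet> p) \<le> (n/2)\<^sup>2 * 1" using P by (intro mult_mono) auto
    moreover have "\<bar>2 * (d \<bullet> p) * (d \<bullet> q) * (p \<bullet> q)\<bar> \<le> n/40 * (n/2) * 2"
    proof -
      have "\<bar>d \<bullet> p\<bar> * \<bar>d \<bullet> q\<bar> \<le> n/40 * (n/2)"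
        using d dq n by (intro mult_mono) (auto simp: n_def)
      then have "(\<bar>d \<bullet> p\<bar> * \<bar>d \<bullet> q\<bar>) * \<bar>p \<bullet> q\<bar> \<le> (n/40 * (n/2)) * 1"
        by (rule mult_mono) (use r n in auto)
      then show ?thesis by (simp add: abs_mult)
    qed
    ultimately show ?thesis by linarith
  qed
  finally have "n\<^sup>2 * (6/10) \<le> n\<^sup>2 * (1/1600 + 1/4 + 1/40)"
    by (simp add: power2_eq_square algebra_simps)
  then show False using n by simp
qed

text \<open>The triangles behind this are \<open>{u, v, w}\<close>, \<open>{u, v', w'}\<close> and
  \<open>{u5, v5, w'}\<close>; the distances above 1 are the missing crossed edges between
  consecutive ones.\<close>

lemma displacement_grows:
  fixes u v w v' w' u5 v5 :: "real^2"
  assumes uvw: "98/100 \<le> dist u v" "dist u v \<le> 1" "98/100 \<le> dist u w" "dist u w \<le> 1"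
      "98/100 \<le> dist v w" "dist v w \<le> 1"
    and near: "dist v' v \<le> 1/100" "dist w' w \<le> 1/100" "dist u5 u \<le> 1/100"
      "dist v5 v' \<le> 1/100"
    and vw: "dist v' w > 1" "dist v' w' \<le> 1" "dist v w' > 1"
    and uv: "dist u v5 > 1" "dist u5 v5 \<le> 1" "dist u5 v' > 1"
    and sign: "(v' - v) \<bullet> (v - u) \<le> 0"
  shows "dist v v' < dist v' v5"
proof -
  let ?d = "v' - v" and ?e = "v5 - v'"
  have sq: "dist a b \<le> 1 \<longleftrightarrow> (norm (b - a))\<^sup>2 \<le> 1" for a b :: "real^2"
    by (simp add: dist_norm norm_minus_commute abs_square_le_1)
  \<comment> \<open>Going from \<open>v\<close> to \<open>v'\<close> leaves the unit disc of
    \<open>w\<close> and enters that of \<open>w'\<close>. With \<open>w\<close> near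
    \<open>w'\<close> this bounds the inner product from both sides.\<close>
  have "\<bar>?d \<bullet> (v - w)\<bar> \<le> norm ?d / 40"
  proof -
    have "\<bar>(norm (v' - w))\<^sup>2 - (norm (v - w))\<^sup>2 - 2 * (?d \<bullet> (v - w))\<bar> \<le> norm ?d / 20"
      using near by (intro norm_sq_perturb) (auto simp: dist_norm)
    moreover have "\<bar>(norm (v' - w'))\<^sup>2 - (norm (v - w'))\<^sup>2 - 2 * (?d \<bullet> (v - w))\<bar> \<le> norm ?d / 20"
      using near by (intro norm_sq_perturb) (auto simp: dist_norm)
    moreover have "(norm (v' - w))\<^sup>2 > 1" "(norm (v - w))\<^sup>2 \<le> 1" "(norm (v' - w'))\<^sup>2 \<le> 1" "(norm (v - w'))\<^sup>2 > 1"
      using vw uvw sq[of w v'] sq[of w v] sq[of w' v'] sq[of w' v] by (auto simp: dist_commute)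
    ultimately show ?thesis by linarith
  qed
  then have "norm ?d / 2 \<le> \<bar>?d \<bullet> (v - u)\<bar>"
    using uvw by (intro near_perpendicular[of "v - w" "v - u"]) (auto simp: dist_norm norm_minus_commute)
  then have s: "?d \<bullet> (v - u) \<le> - (norm ?d / 2)" using sign by simp
  \<comment> \<open>By \<open>s\<close>, the squared distance from \<open>u\<close> to
    \<open>v'\<close> is at most \<open>1 - 19/20 * norm ?d\<close>. As \<open>v5\<close> is outside
    the disc of \<open>u\<close>, \<open>?e\<close> has to make up for this; but \<open>u5\<close>
    allows \<open>?e\<close> almost no component along \<open>v - u\<close>.\<close>
  have "\<bar>(norm (v' - u))\<^sup>2 - (norm (v - u))\<^sup>2 - 2 * (?d \<bullet> (v - u))\<bar> \<le> norm ?d / 20"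
    using near by (intro norm_sq_perturb) (auto simp: dist_norm)
  moreover have "\<bar>(norm (v5 - u))\<^sup>2 - (norm (v' - u))\<^sup>2 - 2 * (?e \<bullet> (v - u))\<bar> \<le> norm ?e / 20"
    using near by (intro norm_sq_perturb) (auto simp: dist_norm)
  moreover have "\<bar>(norm (v5 - u5))\<^sup>2 - (norm (v' - u5))\<^sup>2 - 2 * (?e \<bullet> (v - u))\<bar> \<le> norm ?e / 20"
    using near by (intro norm_sq_perturb) (auto simp: dist_norm)
  moreover have "(norm (v - u))\<^sup>2 \<le> 1" "(norm (v5 - u))\<^sup>2 > 1" "(norm (v5 - u5))\<^sup>2 \<le> 1" "(norm (v' - u5))\<^sup>2 > 1"
    using uv uvw sq[of u v] sq[of u v5] sq[of u5 v5] sq[of u5 v'] by auto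
  ultimately have "19/20 * norm ?d < norm ?e / 10" using s by linarith
  moreover have "0 \<le> norm ?d" by simp
  ultimately have "norm ?d < norm ?e" by linarith
  then show ?thesis by (simp add: dist_norm norm_minus_commute)
qed

section \<open>Planar Vietoris--Rips complexes\<close>

text \<open>Cells of side 1/200, so that the sum of both coordinate differences stays within the
  tolerance 1/100 of the estimates.\<close>

definition grid_cell :: "real^2 \<Rightarrow> int \<times> int"
  where "grid_cell x = (\<lfloor>200 * x $ 1\<rfloor>, \<lfloor>200 * x $ 2\<rfloor>)"

lemma dist_same_grid_cell:
  assumes "grid_cell x = grid_cell y"
  shows "dist x y \<le> 1/100"
proof -
  have floor: "\<bar>a - b\<bar> \<le> 1/200" if "\<lfloor>200 * a\<rfloor> = \<lfloor>200 * b\<rfloor>" for a b :: real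
    using that by linarith
  have "dist x y \<le> \<bar>(x - y) $ 1\<bar> + \<bar>(x - y) $ 2\<bar>"
    using norm_le_l1_cart[of "x - y"] by (simp add: dist_norm sum_2)
  also have "\<dots> \<le> 1/200 + 1/200"
    using assms floor by (intro add_mono) (auto simp: grid_cell_def)
  finally show ?thesis by simp
qed

text \<open>A unit length is 200 cells; the bound 201 leaves room for rounding.\<close>

definition grid_box :: "int \<times> int \<Rightarrow> (int \<times> int) set"
  where "grid_box c = {fst c - 201..fst c + 201} \<times> {snd c - 201..snd c + 201}"

lemma grid_cell_in_box:
  assumes "dist x y \<le> 1"
  shows "grid_cell y \<in> grid_box (grid_cell x)"
proof -
  have "\<bar>(x - y) $ i\<bar> \<le> 1" for i
    using component_le_norm_cart[of "x - y" i] assms by (simp add: dist_norm)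
  then have *: "\<bar>x $ i - y $ i\<bar> \<le> 1" for i by simp
  have floor: "\<lfloor>200 * b\<rfloor> \<in> {\<lfloor>200 * a\<rfloor> - 201..\<lfloor>200 * a\<rfloor> + 201}" if "\<bar>a - b\<bar> \<le> 1" for a b :: real
    using that by (auto simp: abs_le_iff) linarith+
  then show ?thesis
    using *[of 1] *[of 2] by (simp add: grid_cell_def grid_box_def)
qed

lemma card_Pow_grid_box:
  obtains M where "\<And>c. finite (grid_box c) \<and> card (Pow (grid_box c)) \<le> M"
proof -
  have fin: "finite (grid_box c)" and "card (grid_box c) = card (grid_box (0, 0))" for c
    by (auto simp: grid_box_def card_cartesian_product)
  then have "card (Pow (grid_box c)) \<le> 2 ^ card (grid_box (0, 0))" for c
    by (metis card_Pow order_refl)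
  then show ?thesis
    using fin that by blast
qed

locale planar_rips =
  fixes S :: "(real^2) set" and F :: "'k::field itself"
  assumes finite_points: "finite S"
begin

sublocale cell_complex S "\<lambda>x y. dist x y \<le> 1" grid_cell F
proof
  show "finite S" by (rule finite_points)
  show "dist y x \<le> 1" if "dist x y \<le> 1" for x y :: "real^2"
    using that by (simp add: dist_commute)
  show "dist x y \<le> 1" if "grid_cell x = grid_cell y" for x y
    using dist_same_grid_cell[OF that] by simp
qed

lemma cliques_eq_rips: "cliques = rips_complex S"
proof -
  have "(\<forall>x\<in>\<sigma>. \<forall>y\<in>\<sigma>. dist x y \<le> 1) \<longleftrightarrow> diameter \<sigma> \<le> 1" if "\<sigma> \<subseteq> S" for \<sigma>
  proof
    assume "\<forall>x\<in>\<sigma>. \<forall>y\<in>\<sigma>. dist x y \<le> 1"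
    then show "diameter \<sigma> \<le> 1"
      by (intro diameter_le) (auto simp: dist_norm)
  next
    assume d: "diameter \<sigma> \<le> 1"
    \<comment> \<open>As a supremum, \<open>diameter\<close> controls distances only in bounded
      sets.\<close>
    have "bounded \<sigma>"
      using that finite_points finite_imp_bounded finite_subset by blast
    then show "\<forall>x\<in>\<sigma>. \<forall>y\<in>\<sigma>. dist x y \<le> 1"
      using diameter_bounded_bound[of \<sigma>] d by fastforce
  qed
  then show ?thesis by (auto simp: cliques_def rips_complex_def)
qed

lemma eliminable:
  assumes cd: "c \<noteq> d" and Q: "Q \<subseteq> {x \<in> S. grid_cell x = d}" "Q \<noteq> {}"
  shows "\<exists>v\<in>Q. \<exists>h h'. \<forall>u\<in>S. grid_cell u = c \<longrightarrow> dist u v \<le> 1 \<longrightarrow> (\<exists>x\<in>Q - {v}. dist u x \<le> 1) \<longrightarrow>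
    h \<in> Q - {v} \<and> dist u h \<le> 1 \<or> h' \<in> Q - {v} \<and> dist u h' \<le> 1"
proof (cases "\<exists>u\<in>S. grid_cell u = c")
  case False
  then show ?thesis using Q(2) by blast
next
  case True
  then obtain u0 where u0: "grid_cell u0 = c" by blast
  obtain v0 where v0: "v0 \<in> Q" "grid_cell v0 = d" using Q by blast
  define D where "D = dist u0 v0"
  have "u0 \<noteq> v0" using u0 v0 cd by auto
  then have D0: "D > 0" by (simp add: D_def)
  define e where "e = (1 / D) *\<^sub>R (v0 - u0)"
  \<comment> \<open>\<open>e\<close> points from cell \<open>c\<close> to cell \<open>d\<close>, and
    \<open>f\<close> is \<open>e\<close> turned by a right angle; points are ordered along
    \<open>f\<close>.\<close>
  define f :: "real^2" where "f = vector [- (e $ 2), e $ 1]"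
  have ee: "norm e = 1" using D0 by (simp add: e_def D_def dist_norm norm_minus_commute)
  then have e2: "(e $ 1)\<^sup>2 + (e $ 2)\<^sup>2 = 1"
    using power2_norm_eq_inner[of e] by (simp add: inner_vec_def sum_2 power2_eq_square)
  have f12: "f $ 1 = - (e $ 2)" "f $ 2 = e $ 1" by (simp_all add: f_def vector_2)
  have "f \<bullet> f = 1"
    using e2 by (simp add: inner_vec_def sum_2 power2_eq_square f12 add.commute)
  then have ff: "norm f = 1" by (simp add: norm_eq_1)
  have ef: "e \<bullet> f = 0" by (simp add: inner_vec_def sum_2 f12)
  have coord: "(dist a b)\<^sup>2 = (b \<bullet> e - a \<bullet> e)\<^sup>2 + (b \<bullet> f - a \<bullet> f)\<^sup>2" for a b
  proof -
    have "((x \<bullet> e)\<^sup>2 + (x \<bullet> f)\<^sup>2) = (x \<bullet> x) * ((e $ 1)\<^sup>2 + (e $ 2)\<^sup>2)" for x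
      by (simp add: inner_vec_def sum_2 f12 power2_eq_square algebra_simps)
    then have "(norm (b - a))\<^sup>2 = ((b - a) \<bullet> e)\<^sup>2 + ((b - a) \<bullet> f)\<^sup>2"
      using e2 by (simp add: power2_norm_eq_inner)
    then show ?thesis by (simp add: dist_norm norm_minus_commute inner_diff_left)
  qed
  have unit: "dist a b \<le> 1 \<longleftrightarrow> (b \<bullet> e - a \<bullet> e)\<^sup>2 + (b \<bullet> f - a \<bullet> f)\<^sup>2 \<le> 1" for a b
    unfolding coord[symmetric] by (simp add: abs_square_le_1)
  let ?U = "{u \<in> S. grid_cell u = c}"
  have "\<exists>v\<in>Q. \<exists>h h'. \<forall>u\<in>?U. dist u v \<le> 1 \<longrightarrow> (\<exists>x\<in>Q - {v}. dist u x \<le> 1) \<longrightarrow>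
    h \<in> Q - {v} \<and> dist u h \<le> 1 \<or> h' \<in> Q - {v} \<and> dist u h' \<le> 1"
  proof (rule eliminable_if_between[where key = "\<lambda>x. x \<bullet> f"])
    show "finite Q" using Q(1) by (rule finite_subset) (simp add: finite_points)
    show "Q \<noteq> {}" by fact
    fix u u' a b g
    assume U: "u \<in> ?U" "u' \<in> ?U" and abg: "a \<in> Q" "b \<in> Q" "g \<in> Q"
      and key: "a \<bullet> f \<le> b \<bullet> f" "b \<bullet> f \<le> g \<bullet> f"
      and adj: "dist u a \<le> 1" "dist u g \<le> 1" "\<not> dist u b \<le> 1" "dist u' b \<le> 1"
    have nearU: "dist x y \<le> 1/100" if "grid_cell x = c" "grid_cell y = c" for x y
      using dist_same_grid_cell that by simp
    have nearV: "dist x y \<le> 1/100" if "x \<in> Q" "y \<in> Q" for x y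
      using dist_same_grid_cell that Q(1) by auto
    \<comment> \<open>The points \<open>u\<close> and \<open>b\<close> are more than 1 apart, and
      each of \<open>u0\<close>, \<open>v0\<close> is within 1/100 of one of them.\<close>
    have D1: "D \<ge> 98/100"
      using dist_triangle[of u b u0] dist_triangle[of u0 b v0] adj(3)
        nearU[of u u0] nearV[of v0 b] U u0 v0 abg by (simp add: D_def)
    \<comment> \<open>Every vector from cell \<open>c\<close> to \<open>Q\<close> differs from
      \<open>D *\<^sub>R e\<close> by at most 1/50.\<close>
    have err: "\<bar>y \<bullet> e - x \<bullet> e - D\<bar> \<le> 1/50 \<and> \<bar>y \<bullet> f - x \<bullet> f\<bar> \<le> 1/50"
      if "grid_cell x = c" "y \<in> Q" for x y
    proof -
      define r where "r = (y - v0) - (x - u0)"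
      have "norm (y - v0) \<le> 1/100" "norm (x - u0) \<le> 1/100"
        using nearV[OF that(2) v0(1)] nearU[OF that(1) u0] by (simp_all add: dist_norm)
      then have "norm r \<le> 1/50"
        using norm_triangle_ineq4[of "y - v0" "x - u0"] by (simp add: r_def)
      then have r: "\<bar>r \<bullet> e\<bar> \<le> 1/50" "\<bar>r \<bullet> f\<bar> \<le> 1/50"
        using Cauchy_Schwarz_ineq2[of r e] Cauchy_Schwarz_ineq2[of r f] ee ff by auto
      have De: "v0 - u0 = D *\<^sub>R e" using D0 by (simp add: e_def)
      have "y - x = D *\<^sub>R e + r" by (simp add: r_def De[symmetric])
      then have "(y - x) \<bullet> e = D + r \<bullet> e" "(y - x) \<bullet> f = r \<bullet> f"
        using ee ef power2_norm_eq_inner[of e] by (simp_all add: inner_add_left)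
      then show ?thesis using r by (simp add: inner_diff_left)
    qed
    have Ucell: "grid_cell u = c" "grid_cell u' = c" using U by auto
    have ex: "y \<bullet> e - x \<bullet> e \<ge> 9/10" "\<bar>y \<bullet> f - x \<bullet> f\<bar> \<le> 1/10" "\<bar>- (y \<bullet> f) - - (x \<bullet> f)\<bar> \<le> 1/10"
      if "grid_cell x = c" "y \<in> Q" for x y
      using err[OF that, THEN conjunct1] err[OF that, THEN conjunct2] D1 by linarith+
    have smallU: "\<bar>u' \<bullet> e - u \<bullet> e\<bar> \<le> 1/50"
      using Cauchy_Schwarz_ineq2[of "u' - u" e] nearU[OF Ucell(2,1)] ee
      by (simp add: inner_diff_left dist_norm)
    have smallV: "\<bar>y \<bullet> e - x \<bullet> e\<bar> \<le> 1/50" if "x \<in> Q" "y \<in> Q" for x y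
      using Cauchy_Schwarz_ineq2[of "y - x" e] nearV[OF that(2,1)] ee
      by (simp add: inner_diff_left dist_norm)
    show "dist u' a \<le> 1 \<or> dist u' g \<le> 1"
    proof (cases "u \<bullet> f \<le> u' \<bullet> f")
      case True
      have "(g \<bullet> e - u' \<bullet> e)\<^sup>2 + (g \<bullet> f - u' \<bullet> f)\<^sup>2 \<le> 1"
        by (rule between_core[where ux = "u \<bullet> e" and px = "b \<bullet> e" and uy = "u \<bullet> f" and py = "b \<bullet> f"])
          (use adj[unfolded unit] key True ex Ucell abg smallU smallV in \<open>auto simp: not_le\<close>)
      then show ?thesis by (simp add: unit)
    next
      case False
      have sq: "(- p - - q)\<^sup>2 = (p - q)\<^sup>2" for p q :: real by (simp add: power2_eq_square algebra_simps)
      \<comment> \<open>Reflection in the axis \<open>e\<close> negates the second coordinates, so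
        that \<open>u'\<close> and \<open>a\<close> now lie on the upper side of \<open>u\<close>
        and \<open>b\<close>.\<close>
      have "(a \<bullet> e - u' \<bullet> e)\<^sup>2 + (- (a \<bullet> f) - - (u' \<bullet> f))\<^sup>2 \<le> 1"
        by (rule between_core[where ux = "u \<bullet> e" and px = "b \<bullet> e" and uy = "- (u \<bullet> f)" and py = "- (b \<bullet> f)"])
          (use adj[unfolded unit] key False ex Ucell abg smallU smallV in \<open>auto simp only: sq not_le neg_le_iff_le\<close>)
      then show ?thesis unfolding sq by (simp add: unit)
    qed
  qed
  then obtain v h h' where v: "v \<in> Q"
    and h: "\<forall>u\<in>?U. dist u v \<le> 1 \<longrightarrow> (\<exists>x\<in>Q - {v}. dist u x \<le> 1) \<longrightarrow>
      h \<in> Q - {v} \<and> dist u h \<le> 1 \<or> h' \<in> Q - {v} \<and> dist u h' \<le> 1"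
    by blast
  show ?thesis
  proof (rule bexI[OF _ v], rule exI[of _ h], rule exI[of _ h'], intro ballI impI)
    fix u assume "u \<in> S" "grid_cell u = c" and u: "dist u v \<le> 1" "\<exists>x\<in>Q - {v}. dist u x \<le> 1"
    then have "u \<in> ?U" by simp
    from h[THEN bspec, OF this, THEN mp, THEN mp, OF u]
    show "h \<in> Q - {v} \<and> dist u h \<le> 1 \<or> h' \<in> Q - {v} \<and> dist u h' \<le> 1" .
  qed
qed

lemma connected_vertex:
  assumes T: "card T = 3" and Q: "Q \<subseteq> {x \<in> S. grid_cell x \<in> T}" "Q \<noteq> {}"
  shows "\<exists>z\<in>Q. \<forall>t\<in>typed_triangles T Q. \<forall>t'\<in>typed_triangles T Q. z \<in> t \<longrightarrow> z \<in> t' \<longrightarrow>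
    (move T Q)\<^sup>*\<^sup>* t t'"
proof (cases "\<exists>c\<in>T. \<forall>x\<in>Q. \<forall>y\<in>Q. grid_cell x \<noteq> c \<longrightarrow> grid_cell y \<noteq> c \<longrightarrow>
    grid_cell x \<noteq> grid_cell y \<longrightarrow> dist x y \<le> 1")
  case True
  then obtain c where "c \<in> T" "\<And>x y. x \<in> Q \<Longrightarrow> y \<in> Q \<Longrightarrow> grid_cell x \<noteq> c \<Longrightarrow> grid_cell y \<noteq> c \<Longrightarrow>
    grid_cell x \<noteq> grid_cell y \<Longrightarrow> dist x y \<le> 1" by blast
  then show ?thesis by (rule conn_if_complete[OF T Q])
next
  case False
  \<comment> \<open>Every two cells of \<open>T\<close> have points of \<open>Q\<close> more than 1
    apart, and moving each within its cell loses at most 1/100.\<close>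
  have far: "98/100 \<le> dist x y" if xy: "x \<in> Q" "y \<in> Q" "grid_cell x \<noteq> grid_cell y" for x y
  proof -
    have "finite T" using T card.infinite by fastforce
    moreover have "grid_cell x \<in> T" "grid_cell y \<in> T" using xy Q by auto
    ultimately obtain c where c: "T = {grid_cell x, grid_cell y, c}"
      using card_3_with2[OF T _ _ xy(3)] by metis
    obtain p q where pq: "p \<in> Q" "q \<in> Q" "grid_cell p \<noteq> c" "grid_cell q \<noteq> c"
      "grid_cell p \<noteq> grid_cell q" "dist p q > 1"
      using False c by (metis insertCI linorder_not_less)
    have "grid_cell p \<in> T" "grid_cell q \<in> T" using pq Q by auto
    then have "grid_cell p = grid_cell x \<and> grid_cell q = grid_cell y \<or>
      grid_cell p = grid_cell y \<and> grid_cell q = grid_cell x"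
      using c pq by auto
    then show ?thesis
    proof
      assume "grid_cell p = grid_cell x \<and> grid_cell q = grid_cell y"
      then have "dist p x \<le> 1/100" "dist q y \<le> 1/100" using dist_same_grid_cell by auto
      then show ?thesis
        using dist_triangle[of p q x] dist_triangle[of x q y] pq(6) by (simp add: dist_commute)
    next
      assume "grid_cell p = grid_cell y \<and> grid_cell q = grid_cell x"
      then have "dist p y \<le> 1/100" "dist q x \<le> 1/100" using dist_same_grid_cell by auto
      then show ?thesis
        using dist_triangle[of p q y] dist_triangle[of y q x] pq(6) by (simp add: dist_commute)
    qed
  qed
  \<comment> \<open>Unconnected triangles at \<open>x\<close> with corresponding vertices
    \<open>y\<close>, \<open>y'\<close>. A pair in \<open>D\<close> at maximal distance is then
    used.\<close>
  define bad where "bad t t' x y y' \<longleftrightarrow> t \<in> typed_triangles T Q \<and> t' \<in> typed_triangles T Q \<and>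
    x \<in> t \<and> x \<in> t' \<and> y \<in> t \<and> y' \<in> t' \<and> y \<noteq> x \<and> grid_cell y = grid_cell y' \<and>
    \<not> (move T Q)\<^sup>*\<^sup>* t t'" for t t' x y y'
  define D where "D = {(y, y'). \<exists>t t' x. bad t t' x y y'}"
  show ?thesis
  proof (cases "D = {}")
    case True
    have "(move T Q)\<^sup>*\<^sup>* t t'"
      if t: "t \<in> typed_triangles T Q" "t' \<in> typed_triangles T Q" "z \<in> t" "z \<in> t'" for t t' z
    proof (rule ccontr)
      assume nc: "\<not> (move T Q)\<^sup>*\<^sup>* t t'"
      obtain y where y: "y \<in> t" "y \<noteq> z"
        using card_3_with[OF triangleD(1)[OF typed_triangleD(1)[OF t(1)]] t(3)] by (metis insertCI)
      obtain w y' w' where "t' = {z, y', w'}" "grid_cell y = grid_cell y'"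
        using typed_match[OF T t y] by metis
      then have "bad t t' z y y'" using t y nc by (simp add: bad_def)
      then show False using True by (auto simp: D_def)
    qed
    then show ?thesis using Q(2) by blast
  next
    case ne: False
    have "D \<subseteq> Q \<times> Q"
      using typed_triangleD(3) by (auto simp: D_def bad_def)
    moreover have "finite Q" using Q(1) by (rule finite_subset) (simp add: finite_points)
    ultimately have "finite D" by (meson finite_SigmaI finite_subset)
    then have "finite ((\<lambda>(y, y'). dist y y') ` D)" "(\<lambda>(y, y'). dist y y') ` D \<noteq> {}" using ne by auto
    then obtain m where m: "m \<in> (\<lambda>(y, y'). dist y y') ` D" "\<And>r. r \<in> (\<lambda>(y, y'). dist y y') ` D \<Longrightarrow> r \<le> m"
      using Max_in Max_ge by metis
    then obtain y y' where mD: "(y, y') \<in> D" "m = dist y y'" by auto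
    have max: "dist p q \<le> m" if "bad t t' x p q" for t t' x p q
      using m(2)[of "dist p q"] that by (force simp: D_def)
    obtain t t' x where "bad t t' x y y'" using mD by (auto simp: D_def)
    have bad_sym: "bad t' t x y' y" if "bad t t' x y y'" for t t' x y y'
    proof -
      have "y' \<noteq> x"
        using that typed_inj[OF _ T, of t Q] by (auto simp: bad_def inj_on_def)
      then show ?thesis using that moves_sym by (auto simp: bad_def)
    qed
    \<comment> \<open>Exchanging the two triangles keeps the distance, and at least one of the two
      orders has the sign wanted.\<close>
    have "\<exists>t t' x y y'. bad t t' x y y' \<and> m = dist y y' \<and> (y' - y) \<bullet> (y - x) \<le> 0"
    proof (cases "(y' - y) \<bullet> (y - x) \<le> 0")
      case True
      then show ?thesis using \<open>bad t t' x y y'\<close> mD by blast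
    next
      case False
      have "(y - y') \<bullet> (y' - x) = - ((y' - y) \<bullet> (y - x)) - (y' - y) \<bullet> (y' - y)"
        by (simp add: inner_diff_left inner_diff_right inner_commute)
      moreover have "0 \<le> (y' - y) \<bullet> (y' - y)" by simp
      ultimately have "(y - y') \<bullet> (y' - x) \<le> 0" using False by linarith
      then show ?thesis
        using bad_sym[OF \<open>bad t t' x y y'\<close>] mD dist_commute by metis
    qed
    then obtain t t' x y y' where bad: "bad t t' x y y'" and m_eq: "m = dist y y'"
      and sign: "(y' - y) \<bullet> (y - x) \<le> 0" by blast
    then have t: "t \<in> typed_triangles T Q" "t' \<in> typed_triangles T Q" "x \<in> t" "x \<in> t'" "y \<in> t" "y \<noteq> x"
      and y': "y' \<in> t'" "grid_cell y = grid_cell y'" and nc: "\<not> (move T Q)\<^sup>*\<^sup>* t t'"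
      by (auto simp: bad_def)
    obtain z y2 z' where tz: "t = {x, y, z}" "t' = {x, y2, z'}" "distinct [x, y, z]" "distinct [x, y2, z']"
      "grid_cell y = grid_cell y2" "grid_cell z = grid_cell z'"
      "grid_cell x \<noteq> grid_cell y" "grid_cell x \<noteq> grid_cell z" "grid_cell y \<noteq> grid_cell z"
      using typed_match[OF T t] by metis
    have "y2 = y'"
      using typed_inj[OF t(2) T] y' tz by (auto simp: inj_on_def)
    note tz = tz[unfolded this]
    note adjt = triangleD(3)[OF typed_triangleD(1)[OF t(1)]] triangleD(3)[OF typed_triangleD(1)[OF t(2)]]
    have inQ: "x \<in> Q" "y \<in> Q" "z \<in> Q" "y' \<in> Q" "z' \<in> Q"
      using typed_triangleD(3)[OF t(1)] typed_triangleD(3)[OF t(2)] tz by auto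
    have reach: "(move T Q)\<^sup>*\<^sup>* t' s" if s: "s \<in> typed_triangles T Q" "z' \<in> s" for s
    proof (rule ccontr)
      assume ns: "\<not> (move T Q)\<^sup>*\<^sup>* t' s"
      have "z' \<in> t'" "y' \<in> t'" "y' \<noteq> z'" using tz by auto
      then obtain x1 y5 x5 where s5: "t' = {z', y', x1}" "s = {z', y5, x5}" "distinct [z', y', x1]"
        "distinct [z', y5, x5]" "grid_cell y' = grid_cell y5" "grid_cell x1 = grid_cell x5"
        "grid_cell z' \<noteq> grid_cell y'" "grid_cell z' \<noteq> grid_cell x1" "grid_cell y' \<noteq> grid_cell x1"
        using typed_match[OF T t(2) s(1) _ s(2)] by metis
      have "x1 = x" using s5(1,3) tz(2,4) by auto
      note s5 = s5[unfolded this]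
      note adjs = triangleD(3)[OF typed_triangleD(1)[OF s(1)]]
      \<comment> \<open>The triangles \<open>t'\<close> and \<open>s\<close> are also unconnected,
        now at \<open>z'\<close>, so maximality bounds the step from \<open>y'\<close> to
        \<open>y5\<close>.\<close>
      have "bad t' s z' y' y5"
        unfolding bad_def using t(2) s(1) ns s5 by auto
      then have le: "dist y' y5 \<le> dist y y'" using max m_eq by metis
      have ne: "y \<noteq> z'" "y' \<noteq> z" "y' \<noteq> x5" "y5 \<noteq> x" using tz s5 by metis+
      \<comment> \<open>Any of these four crossed edges would connect two triangles that are not
        connected.\<close>
      have n1: "dist y z' > 1"
      proof (rule ccontr)
        assume "\<not> ?thesis"
        then show False using moves_if_adj[of x y z T Q y' z'] nc t tz ne by simp
      qed
      have n2: "dist y' z > 1"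
      proof (rule ccontr)
        assume "\<not> ?thesis"
        then show False using moves_if_adj'[of x y z T Q y' z'] nc t tz ne by simp
      qed
      have n3: "dist y' x5 > 1"
      proof (rule ccontr)
        assume "\<not> ?thesis"
        then show False using moves_if_adj[of z' y' x T Q y5 x5] ns t(2) s(1) s5 ne by simp
      qed
      have n4: "dist y5 x > 1"
      proof (rule ccontr)
        assume "\<not> ?thesis"
        then show False using moves_if_adj'[of z' y' x T Q y5 x5] ns t(2) s(1) s5 ne by simp
      qed
      have "dist y y' < dist y' y5"
      proof (rule displacement_grows[of x y z y' z' x5 y5])
        show "98/100 \<le> dist x y" "98/100 \<le> dist x z" "98/100 \<le> dist y z"
          using far inQ tz by auto
        show "dist x y \<le> 1" "dist x z \<le> 1" "dist y z \<le> 1" "dist y' z' \<le> 1"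
          using adjt tz by auto
        show "dist y' y \<le> 1/100" "dist z' z \<le> 1/100" "dist x5 x \<le> 1/100" "dist y5 y' \<le> 1/100"
          by (intro dist_same_grid_cell; use tz(5,6) s5(5,6) in simp)+
        show "dist x5 y5 \<le> 1" by (rule adjs) (simp_all add: s5(2))
        show "dist y' z > 1" "dist y z' > 1" "dist x y5 > 1" "dist x5 y' > 1"
          using n1 n2 n3 n4 by (simp_all add: dist_commute)
      qed (fact sign)
      then show False using le by simp
    qed
    have "(move T Q)\<^sup>*\<^sup>* s s'"
      if "s \<in> typed_triangles T Q" "s' \<in> typed_triangles T Q" "z' \<in> s" "z' \<in> s'" for s s'
      using rtranclp_trans[OF moves_sym[OF reach[OF that(1,3)]] reach[OF that(2,4)]] .
    then show ?thesis using inQ by blast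
  qed
qed

text \<open>Double counting: a point contributes once for each cell set of a triangle that contains
  its cell.\<close>

lemma reduced_betti_rips_le:
  assumes M: "\<And>c. finite (grid_box c) \<and> card (Pow (grid_box c)) \<le> M"
  shows "reduced_betti F (rips_complex S) 2 \<le> M * card S"
proof -
  let ?T = "(`) grid_cell ` triangles"
  have "reduced_betti F (rips_complex S) 2 \<le> (\<Sum>T\<in>?T. card {x \<in> S. grid_cell x \<in> T})"
    unfolding cliques_eq_rips[symmetric] by (rule reduced_betti_le_sum[OF eliminable connected_vertex])
  also have "\<dots> = (\<Sum>T\<in>?T. \<Sum>x\<in>S. if grid_cell x \<in> T then 1 else 0)"
    using finite_points by (intro sum.cong refl) (simp only: card_eq_sum sum.inter_filter finite_imageI)
  also have "\<dots> = (\<Sum>x\<in>S. \<Sum>T\<in>?T. if grid_cell x \<in> T then 1 else 0)"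
    by (rule sum.swap)
  also have "\<dots> = (\<Sum>x\<in>S. card {T \<in> ?T. grid_cell x \<in> T})"
    using finite_triangles by (intro sum.cong refl) (simp only: card_eq_sum sum.inter_filter finite_imageI)
  also have "\<dots> \<le> (\<Sum>x\<in>S. M)"
  proof (rule sum_mono)
    fix x assume "x \<in> S"
    \<comment> \<open>The triangle has a vertex \<open>p\<close> in the cell of \<open>x\<close>,
      and all its vertices are within distance 1 of \<open>p\<close>. The box depends only on the
      cell.\<close>
    have "{T \<in> ?T. grid_cell x \<in> T} \<subseteq> Pow (grid_box (grid_cell x))"
    proof
      fix T assume "T \<in> {T \<in> ?T. grid_cell x \<in> T}"
      then obtain t p where t: "t \<in> triangles" "T = grid_cell ` t" "p \<in> t" "grid_cell x = grid_cell p" by auto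
      then have "grid_cell q \<in> grid_box (grid_cell x)" if "q \<in> t" for q
        using grid_cell_in_box[of p q] triangleD(3)[OF t(1)] that by simp
      then show "T \<in> Pow (grid_box (grid_cell x))" using t by auto
    qed
    then have "card {T \<in> ?T. grid_cell x \<in> T} \<le> card (Pow (grid_box (grid_cell x)))"
      using M by (intro card_mono) auto
    also have "\<dots> \<le> M" using M by blast
    finally show "card {T \<in> ?T. grid_cell x \<in> T} \<le> M" .
  qed
  also have "\<dots> = M * card S" by simp
  finally show ?thesis .
qed

end

theorem theorem4p1:
  shows "\<exists>D::real. \<forall>n::nat. real (max_rips_betti TYPE('k::field) TYPE(2) 2 n) \<le> D * real n"
proof -
  obtain M where M: "\<And>c. finite (grid_box c) \<and> card (Pow (grid_box c)) \<le> M"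
    using card_Pow_grid_box by blast
  have "max_rips_betti TYPE('k) TYPE(2) 2 n \<le> M * n" for n
  proof -
    let ?A = "{reduced_betti TYPE('k) (rips_complex S) 2 |S :: (real ^ 2) set. finite S \<and> card S \<le> n}"
    have bound: "b \<le> M * n" if b: "b \<in> ?A" for b
    proof -
      obtain S :: "(real^2) set" where S: "finite S" "card S \<le> n"
        "b = reduced_betti TYPE('k) (rips_complex S) 2"
        using b by blast
      interpret planar_rips S "TYPE('k)" by unfold_locales (rule S(1))
      have "b \<le> M * card S" unfolding S(3) by (rule reduced_betti_rips_le[OF M])
      also have "\<dots> \<le> M * n" using S(2) by simp
      finally show ?thesis .
    qed
    \<comment> \<open>\<open>Max\<close> has its meaning only on finite nonempty sets: the bound
      gives finiteness, and the empty point set gives a member.\<close>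
    then have "finite ?A" by (intro finite_subset[of ?A "{..M * n}"]) auto
    moreover have "?A \<noteq> {}" by (auto intro: exI[of _ "{}"])
    ultimately show ?thesis
      using bound unfolding max_rips_betti_def by (subst Max_le_iff) auto
  qed
  then have "real (max_rips_betti TYPE('k) TYPE(2) 2 n) \<le> real M * real n" for n
    by (metis of_nat_le_iff of_nat_mult)
  then show ?thesis by blast
qed

end
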